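(* There is an incremental transitive cover data structure (ITCO) on an $n$-element node set $\mathcal{V}$ that can be implemented with the following properties, where $\mathcal{E}_{\rm final}$ denotes $\mathcal{E}$ after the last TcAdd operation: (1) TcInit and all TcAdd operations run in total time $O((n+|\mathcal{E}_{\rm final}|)n)$; (2) $\mathrm{TcCover}(S)$ runs in $O(\min\{|S|^2,|\mathcal{E}|\})$ time and returns a cover with $O(\min\{|S|^2,|\mathcal{E}|\})$ arcs; (3) $\mathrm{TcWitList}()$ returns a witness list of length $O(n^2)$ in time $O(n^2)$.
   Context: For a directed graph $(\mathcal{V},\mathcal{E})$, $\mathcal{E}^{\rm tr}$ is the set of pairs $(i,j)$, $i\ne j$, with a directed $i$–$j$ path in $\mathcal{E}$; $\mathcal{E}^{\rm tr}[S]$ restricts to pairs inside $S$. For $S\subseteq\mathcal{V}$, $(\mathcal{V}',F)$ is a transitive cover of $S$ if $S\subseteq\mathcal{V}'\subseteq\mathcal{V}$, $F\subseteq\mathcal{E}^{\rm tr}[\mathcal{V}']$ and $F^{\rm tr}[S]=\mathcal{E}^{\rm tr}[S]$. A witness list on $\mathcal{V}$ is a sequence $L=(a_i,b_i,w_i)_{i\in[K]}$ in $\mathcal{V}^3$ (its length is $K$) with distinct pairs $(a_i,b_i)$, $a_i\ne b_i$, such that whenever $w_i\neq b_i$ there are $j_i,k_i\in[i-1]$ with $(a_i,w_i)=(a_{j_i},b_{j_i})$, $(w_i,b_i)=(a_{k_i},b_{k_i})$. $\mathcal{E}(L)=\{(a_i,b_i):w_i=b_i\}$, $\mathcal{E}_{\le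 j}(L)=\{(a_i,b_i)\in\mathcal{E}(L): i\le j\}$; $\mathrm{walk}_L(a_i,b_i)$ is $(a_i,b_i)$ if $w_i=b_i$ and otherwise $\mathrm{walk}_L(a_i,w_i)$ followed by $\mathrm{walk}_L(w_i,b_i)$; $L$ is path-structured if all these walks are paths. An ITCO supports $\mathrm{TcInit}(\mathcal{V})$ (start with $\mathcal{E}=\emptyset$), $\mathrm{TcAdd}(F)$ (for $F\subseteq \mathcal{V}\times\mathcal{V}$ with $F\cap\mathcal{E}=\emptyset$ and no self-loops, $\mathcal{E}\gets\mathcal{E}\cup F$), $\mathrm{TcCover}(S)$ (outputs a transitive cover of $S$ in the current $(\mathcal{V},\mathcal{E})$), and $\mathrm{TcWitList}()$ (returns a path-structured witness list $L$ with $\mathcal{E}(L)\subseteq\mathcal{E}$ such that every arc $(a,b)$ output by TcCover equals some $(a_i,b_i)$ where $\mathcal{E}_{\le i}(L)$ was added before $(a,b)$ was output). Arithmetic and basic operations cost $O(1)$ time.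
   Formalization: Each TcAdd call with the empty set is charged an extra O(1) in bound (1), since unboundedly many such calls cannot be paid for by (n+|E_final|)n; the time bounds O(x) are read as O(1+x), as every call takes at least one step. *)

theory Defs
  imports Main
begin

section \<open>Paths, transitive closure and transitive covers\<close>

type_synonym node = nat
type_synonym arc = "node \<times> node"

definition is_path :: "arc set \<Rightarrow> node list \<Rightarrow> bool" where
  "is_path E p \<longleftrightarrow> p \<noteq> [] \<and> distinct p \<and> (\<forall>i. Suc i < length p \<longrightarrow> (p ! i, p ! Suc i) \<in> E)"

definition tr :: "arc set \<Rightarrow> arc set" where
  "tr E = {(i, j). i \<noteq> j \<and> (\<exists>p. is_path E p \<and> hd p = i \<and> last p = j)}"

definition tr_on :: "arc set \<Rightarrow> node set \<Rightarrow> arc set" where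
  "tr_on E S = tr E \<inter> S \<times> S"

definition transitive_cover ::
  "node set \<Rightarrow> arc set \<Rightarrow> node set \<Rightarrow> node set \<Rightarrow> arc set \<Rightarrow> bool" where
  "transitive_cover V E S V' F \<longleftrightarrow>
     S \<subseteq> V' \<and> V' \<subseteq> V \<and> F \<subseteq> tr_on E V' \<and> tr_on F S = tr_on E S"


section \<open>Witness lists\<close>

type_synonym witness = "node \<times> node \<times> node"

fun wpair :: "witness \<Rightarrow> arc" where
  "wpair (a, b, w) = (a, b)"

definition witness_list :: "node set \<Rightarrow> witness list \<Rightarrow> bool" where
  "witness_list V L \<longleftrightarrow>
     set L \<subseteq> V \<times> V \<times> V \<and> distinct (map wpair L) \<and> (\<forall>(a, b, w) \<in> set L. a \<noteq> b) \<and>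
     (\<forall>i < length L. \<forall>a b w. L ! i = (a, b, w) \<and> w \<noteq> b \<longrightarrow>
        (\<exists>j < i. \<exists>k < i. (a, w) = wpair (L ! j) \<and> (w, b) = wpair (L ! k)))"

definition wl_arcs :: "witness list \<Rightarrow> arc set" where
  "wl_arcs L = {(a, b). (a, b, b) \<in> set L}"

text \<open>List positions are counted from 0, so the entries up to and including position \<open>i\<close>
  form the prefix of length \<open>Suc i\<close>.\<close>

definition wl_arcs_upto :: "witness list \<Rightarrow> nat \<Rightarrow> arc set" where
  "wl_arcs_upto L i = wl_arcs (take (Suc i) L)"

text \<open>\<open>wl_walk L a b p\<close>: the node sequence of the walk of \<open>L\<close> for the pair \<open>(a, b)\<close> is \<open>p\<close>.
  For a witness list, \<open>p\<close> exists and is unique for each pair occurring in the list.\<close>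

inductive wl_walk :: "witness list \<Rightarrow> node \<Rightarrow> node \<Rightarrow> node list \<Rightarrow> bool" for L where
  arc: "(a, b, b) \<in> set L \<Longrightarrow> wl_walk L a b [a, b]"
| comp: "(a, b, w) \<in> set L \<Longrightarrow> w \<noteq> b \<Longrightarrow> wl_walk L a w p \<Longrightarrow> wl_walk L w b q
    \<Longrightarrow> wl_walk L a b (p @ tl q)"

definition path_structured :: "witness list \<Rightarrow> bool" where
  "path_structured L \<longleftrightarrow> (\<forall>(a, b, w) \<in> set L. \<exists>p. wl_walk L a b p \<and> distinct p)"


section \<open>Unit-cost random access machine\<close>

text \<open>Programs have finitely many registers and a memory that consists of arrays. Arrays are
  referred to by numbers, so references to arrays can be computed, stored and returned.
  Expressions only contain a constant number of memory accesses and of operations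
  \<open>+\<close>, \<open>-\<close> (truncated), \<open>*\<close>, \<open><\<close>, \<open>=\<close>, fixed by the program text; hence evaluating an expression
  takes constant time, and each executed assignment, memory write and test is charged one unit.\<close>

type_synonym reg = string

record state =
  regs :: "reg \<Rightarrow> nat"
  mem :: "nat \<Rightarrow> nat \<Rightarrow> nat"

datatype aexp =
    Const nat
  | Reg reg
  | Cell aexp aexp
  | Plus aexp aexp
  | Minus aexp aexp
  | Times aexp aexp

datatype bexp =
    Less aexp aexp
  | Equal aexp aexp
  | Neg bexp
  | Conj bexp bexp

datatype com =
    Skip
  | Assign reg aexp
  | Write aexp aexp aexp
  | Seq com com
  | Cond bexp com com
  | While bexp com

fun aval :: "aexp \<Rightarrow> state \<Rightarrow> nat" where
  "aval (Const k) s = k"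
| "aval (Reg x) s = regs s x"
| "aval (Cell r i) s = mem s (aval r s) (aval i s)"
| "aval (Plus e f) s = aval e s + aval f s"
| "aval (Minus e f) s = aval e s - aval f s"
| "aval (Times e f) s = aval e s * aval f s"

fun bval :: "bexp \<Rightarrow> state \<Rightarrow> bool" where
  "bval (Less e f) s \<longleftrightarrow> aval e s < aval f s"
| "bval (Equal e f) s \<longleftrightarrow> aval e s = aval f s"
| "bval (Neg b) s \<longleftrightarrow> \<not> bval b s"
| "bval (Conj b c) s \<longleftrightarrow> bval b s \<and> bval c s"

definition set_reg :: "reg \<Rightarrow> nat \<Rightarrow> state \<Rightarrow> state" where
  "set_reg x v s = s\<lparr>regs := (regs s)(x := v)\<rparr>"

definition set_cell :: "nat \<Rightarrow> nat \<Rightarrow> nat \<Rightarrow> state \<Rightarrow> state" where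
  "set_cell r i v s = s\<lparr>mem := (mem s)(r := (mem s r)(i := v))\<rparr>"

text \<open>\<open>exec c s t s'\<close>: started in state \<open>s\<close>, program \<open>c\<close> terminates in state \<open>s'\<close> after time \<open>t\<close>.\<close>

inductive exec :: "com \<Rightarrow> state \<Rightarrow> nat \<Rightarrow> state \<Rightarrow> bool" where
  Skip: "exec Skip s 1 s"
| Assign: "exec (Assign x e) s 1 (set_reg x (aval e s) s)"
| Write: "exec (Write r i e) s 1 (set_cell (aval r s) (aval i s) (aval e s) s)"
| Seq: "exec c s t s' \<Longrightarrow> exec d s' u s'' \<Longrightarrow> exec (Seq c d) s (t + u) s''"
| CondTrue: "bval b s \<Longrightarrow> exec c s t s' \<Longrightarrow> exec (Cond b c d) s (1 + t) s'"
| CondFalse: "\<not> bval b s \<Longrightarrow> exec d s t s' \<Longrightarrow> exec (Cond b c d) s (1 + t) s'"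
| WhileFalse: "\<not> bval b s \<Longrightarrow> exec (While b c) s 1 s"
| WhileTrue: "bval b s \<Longrightarrow> exec c s t s' \<Longrightarrow> exec (While b c) s' u s''
    \<Longrightarrow> exec (While b c) s (1 + t + u) s''"

inductive_cases exec_SkipE: "exec Skip s t s'"
inductive_cases exec_AssignE: "exec (Assign x e) s t s'"
inductive_cases exec_WriteE: "exec (Write r i e) s t s'"
inductive_cases exec_SeqE: "exec (Seq c d) s t s'"
inductive_cases exec_CondE: "exec (Cond b c d) s t s'"
inductive_cases exec_WhileE: "exec (While b c) s t s'"

lemma exec_deterministic:
  "exec c s t s' \<Longrightarrow> exec c s u s'' \<Longrightarrow> t = u \<and> s' = s''"
proof (induction arbitrary: u s'' rule: exec.induct)
  case (Seq c s t s' d v s2)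
  from Seq.prems obtain t1 s1 t2 where "exec c s t1 s1" "exec d s1 t2 s''" "u = t1 + t2"
    by (rule exec_SeqE)
  with Seq.IH show ?case by blast
next
  case (CondTrue b s c t s' d)
  from CondTrue.prems CondTrue.hyps obtain t1 where "exec c s t1 s''" "u = 1 + t1"
    by (auto elim: exec_CondE)
  with CondTrue.IH show ?case by blast
next
  case (CondFalse b s d t s' c)
  from CondFalse.prems CondFalse.hyps obtain t1 where "exec d s t1 s''" "u = 1 + t1"
    by (auto elim: exec_CondE)
  with CondFalse.IH show ?case by blast
next
  case (WhileFalse b s c)
  from WhileFalse.prems WhileFalse.hyps show ?case by (auto elim: exec_WhileE)
next
  case (WhileTrue b s c t s' v s2)
  from WhileTrue.prems WhileTrue.hyps obtain t1 s1 t2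
    where "exec c s t1 s1" "exec (While b c) s1 t2 s''" "u = 1 + t1 + t2"
    by (auto elim: exec_WhileE)
  with WhileTrue.IH show ?case by blast
qed (auto elim: exec_SkipE exec_AssignE exec_WriteE)


section \<open>Incremental transitive cover data structures\<close>

datatype tc_op = TcAdd "arc list" | TcCover "node list" | TcWitList

record itco =
  init_code :: com
  add_code :: com
  cover_code :: com
  witlist_code :: com

fun op_code :: "itco \<Rightarrow> tc_op \<Rightarrow> com" where
  "op_code D (TcAdd F) = add_code D"
| "op_code D (TcCover S) = cover_code D"
| "op_code D TcWitList = witlist_code D"

text \<open>Sets are passed as arrays without repetitions, in any order. The caller of an operation
  puts the argument into the arrays 0 and 1 (an arc set is passed as its tails and heads) and
  its length into register \<open>len\<close>.\<close>

definition put_array :: "nat \<Rightarrow> nat list \<Rightarrow> state \<Rightarrow> state" where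
  "put_array r xs s =
     s\<lparr>mem := (mem s)(r := (\<lambda>i. if i < length xs then xs ! i else mem s r i))\<rparr>"

definition pass_nodes :: "node list \<Rightarrow> state \<Rightarrow> state" where
  "pass_nodes S s = set_reg ''len'' (length S) (put_array 0 S s)"

definition pass_arcs :: "arc list \<Rightarrow> state \<Rightarrow> state" where
  "pass_arcs F s =
     set_reg ''len'' (length F) (put_array 0 (map fst F) (put_array 1 (map snd F) s))"

fun pass_args :: "tc_op \<Rightarrow> state \<Rightarrow> state" where
  "pass_args (TcAdd F) s = pass_arcs F s"
| "pass_args (TcCover S) s = pass_nodes S s"
| "pass_args TcWitList s = s"

text \<open>Results are returned by reference: registers hold the numbers of the arrays in which the
  components of the result are found, and the lengths of these arrays.\<close>

definition get_array :: "reg \<Rightarrow> reg \<Rightarrow> state \<Rightarrow> nat list" where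
  "get_array ref len s = map (mem s (regs s ref)) [0..<regs s len]"

definition cover_nodes :: "state \<Rightarrow> node list" where
  "cover_nodes s = get_array ''nodes'' ''nodes_len'' s"

definition cover_arcs :: "state \<Rightarrow> arc list" where
  "cover_arcs s = zip (get_array ''tails'' ''arcs_len'' s) (get_array ''heads'' ''arcs_len'' s)"

definition result_wl :: "state \<Rightarrow> witness list" where
  "result_wl s = zip (get_array ''wl_a'' ''wl_len'' s)
     (zip (get_array ''wl_b'' ''wl_len'' s) (get_array ''wl_w'' ''wl_len'' s))"

text \<open>A run records, for each operation, its running time and the state it ends in.\<close>

inductive run_ops :: "itco \<Rightarrow> state \<Rightarrow> tc_op list \<Rightarrow> (nat \<times> state) list \<Rightarrow> bool" for D where
  Nil: "run_ops D s [] []"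
| Cons: "exec (op_code D x) (pass_args x s) t s' \<Longrightarrow> run_ops D s' xs h
    \<Longrightarrow> run_ops D s (x # xs) ((t, s') # h)"

text \<open>\<open>session D Vs xs t\<^sub>0 h\<close>: from some initial content of registers and memory (nothing is
  assumed about it), \<open>TcInit\<close> with the nodes \<open>Vs\<close> takes time \<open>t\<^sub>0\<close>, and then the operations
  \<open>xs\<close> give the run \<open>h\<close>.\<close>

definition session_from ::
  "state \<Rightarrow> itco \<Rightarrow> node list \<Rightarrow> tc_op list \<Rightarrow> nat \<Rightarrow> (nat \<times> state) list \<Rightarrow> bool" where
  "session_from s D Vs xs t\<^sub>0 h \<longleftrightarrow>
     (\<exists>s\<^sub>0. exec (init_code D) (pass_nodes Vs s) t\<^sub>0 s\<^sub>0 \<and> run_ops D s\<^sub>0 xs h)"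

definition session ::
  "itco \<Rightarrow> node list \<Rightarrow> tc_op list \<Rightarrow> nat \<Rightarrow> (nat \<times> state) list \<Rightarrow> bool" where
  "session D Vs xs t\<^sub>0 h \<longleftrightarrow> (\<exists>s. session_from s D Vs xs t\<^sub>0 h)"

text \<open>The arc set \<open>\<E>\<close> just before the operation at position \<open>k\<close>.\<close>

definition arcs_before :: "tc_op list \<Rightarrow> nat \<Rightarrow> arc set" where
  "arcs_before xs k = (\<Union>F \<in> {F. TcAdd F \<in> set (take k xs)}. set F)"

definition arcs_final :: "tc_op list \<Rightarrow> arc set" where
  "arcs_final xs = arcs_before xs (length xs)"

definition admissible :: "node set \<Rightarrow> tc_op list \<Rightarrow> bool" where
  "admissible V xs \<longleftrightarrow> (\<forall>k < length xs.
     (\<forall>F. xs ! k = TcAdd F \<longrightarrow> distinct F \<and> set F \<subseteq> V \<times> V \<and>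
        set F \<inter> arcs_before xs k = {} \<and> (\<forall>(a, b) \<in> set F. a \<noteq> b)) \<and>
     (\<forall>S. xs ! k = TcCover S \<longrightarrow> distinct S \<and> set S \<subseteq> V))"

definition correct_cover ::
  "node set \<Rightarrow> tc_op list \<Rightarrow> (nat \<times> state) list \<Rightarrow> nat \<Rightarrow> node list \<Rightarrow> bool" where
  "correct_cover V xs h k S \<longleftrightarrow> (let s = snd (h ! k) in
     distinct (cover_nodes s) \<and> distinct (cover_arcs s) \<and>
     transitive_cover V (arcs_before xs k) (set S) (set (cover_nodes s)) (set (cover_arcs s)))"

definition correct_witlist ::
  "node set \<Rightarrow> tc_op list \<Rightarrow> (nat \<times> state) list \<Rightarrow> nat \<Rightarrow> bool" where
  "correct_witlist V xs h k \<longleftrightarrow> (let L = result_wl (snd (h ! k)) in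
     witness_list V L \<and> path_structured L \<and> wl_arcs L \<subseteq> arcs_before xs k \<and>
     (\<forall>j < k. \<forall>S. xs ! j = TcCover S \<longrightarrow>
        (\<forall>(a, b) \<in> set (cover_arcs (snd (h ! j))).
           \<exists>i < length L. (a, b) = wpair (L ! i) \<and> wl_arcs_upto L i \<subseteq> arcs_before xs j)))"

definition is_ITCO :: "itco \<Rightarrow> bool" where
  "is_ITCO D \<longleftrightarrow> (\<forall>Vs xs. distinct Vs \<and> admissible (set Vs) xs \<longrightarrow>
     (\<forall>s. \<exists>t\<^sub>0 h. session_from s D Vs xs t\<^sub>0 h) \<and>
     (\<forall>t\<^sub>0 h. session D Vs xs t\<^sub>0 h \<longrightarrow> (\<forall>k < length xs.
        (\<forall>S. xs ! k = TcCover S \<longrightarrow> correct_cover (set Vs) xs h k S) \<and>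
        (xs ! k = TcWitList \<longrightarrow> correct_witlist (set Vs) xs h k))))"

definition update_time :: "tc_op list \<Rightarrow> nat \<Rightarrow> (nat \<times> state) list \<Rightarrow> nat" where
  "update_time xs t\<^sub>0 h = t\<^sub>0 + (\<Sum>k \<in> {k. k < length xs \<and> (\<exists>F. xs ! k = TcAdd F)}. fst (h ! k))"

text \<open>A call of \<open>TcAdd\<close> with the empty set leaves \<open>\<E>\<close> unchanged but takes at least one step, so no
  function of \<open>n\<close> and the final arc set bounds the cost of arbitrarily many such calls. They are
  counted separately.\<close>

definition empty_adds :: "tc_op list \<Rightarrow> nat" where
  "empty_adds xs = length (filter (\<lambda>x. x = TcAdd []) xs)"

end

theory Submission
  imports Defs
begin

text \<open>The data structure stores the reachability table together with the witness list, and the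
  witness list doubles as the queue of a breadth-first search run simultaneously from all roots.
  An arc \<open>(u, v)\<close> whose head is already reachable from its tail is recorded but not used for the
  search. Otherwise \<open>(u, v, v)\<close> is appended, then \<open>(r, v, u)\<close> for every \<open>r\<close> that reaches \<open>u\<close> but not
  \<open>v\<close>; processing the entry of a pair \<open>(r, x)\<close> appends \<open>(r, y, x)\<close> for each successor \<open>y\<close> of \<open>x\<close> not
  yet reached from \<open>r\<close>. Every pair is queued at most once, and the search scans each arc at most
  once per root, which gives \<open>O((n + |\<E>|) n)\<close> in total. A cover of \<open>S\<close> is the closure
  restricted to \<open>S\<close> if \<open>|S|\<^sup>2 \<le> |\<E>|\<close>, and the stored graph itself otherwise, returned by
  reference.\<close>

section \<open>Reachability\<close>

text \<open>The queue never has to be rewound. Inserting \<open>(u, v)\<close> changes the successor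
  list of \<open>u\<close> only, so among the entries already processed just those of pairs
  \<open>(r, u)\<close> can become incomplete, and one scan over all nodes, O(n) steps per inserted
  arc, repairs them. All remaining search then concerns entries behind the old end of the queue. The
  time is amortised against \<open>potential\<close>, the number of rounds that the search takes on
  the whole queue with the current successor lists. An addition spends at most 12 times the increase
  of \<open>potential\<close>, plus O(n) per arc and O(1) per call, and these bounds telescope. Arcs
  left out of the search do no harm: their pairs are already generated by the arcs in the list, so
  the reflexive transitive closure is unchanged. Being pairs of the list, they also have entries for
  \<open>TcWitList\<close> to offer when a cover returns the stored graph.\<close>

lemma is_path_imp_rtrancl:
  assumes "is_path E p"
  shows "(hd p, last p) \<in> E\<^sup>*"
proof -
  have "(p ! 0, p ! i) \<in> E\<^sup>*" if "i < length p" for i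
    using that
  proof (induction i)
    case (Suc i)
    then have "(p ! i, p ! Suc i) \<in> E" using assms by (simp add: is_path_def)
    with Suc show ?case by (meson Suc_lessD rtrancl.rtrancl_into_rtrancl)
  qed simp
  moreover have "p \<noteq> []" using assms by (simp add: is_path_def)
  ultimately show ?thesis by (simp add: hd_conv_nth last_conv_nth)
qed

lemma rtrancl_imp_is_path:
  assumes "(a, b) \<in> E\<^sup>*"
  shows "\<exists>p. is_path E p \<and> hd p = a \<and> last p = b"
  using assms
proof (induction rule: rtrancl_induct)
  case base
  have "is_path E [a]" by (simp add: is_path_def)
  then show ?case by force
next
  case (step y z)
  then obtain p where p: "is_path E p" "hd p = a" "last p = y" by blast
  then have ne: "p \<noteq> []" by (simp add: is_path_def)
  show ?case
  proof (cases "z \<in> set p")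
    case True
    \<comment> \<open>Appending \<open>z\<close> would destroy distinctness, so the path is cut at
      its earlier visit to \<open>z\<close>.\<close>
    then obtain i where i: "i < length p" "p ! i = z" by (auto simp: in_set_conv_nth)
    have "is_path E (take (Suc i) p)" using p(1) by (auto simp: is_path_def)
    moreover have "last (take (Suc i) p) = z" using i by (simp add: take_Suc_conv_app_nth)
    ultimately show ?thesis using p(2) ne by (intro exI[of _ "take (Suc i) p"]) simp
  next
    case False
    have "is_path E (p @ [z])"
      unfolding is_path_def
    proof (intro conjI allI impI)
      fix i assume i: "Suc i < length (p @ [z])"
      show "((p @ [z]) ! i, (p @ [z]) ! Suc i) \<in> E"
      proof (cases "Suc i < length p")
        case True
        then show ?thesis using p(1) by (simp add: is_path_def nth_append)
      next
        case False
        with i have "Suc i = length p" by simp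
        then show ?thesis using step.hyps(2) p(3) ne
          by (auto simp: nth_append last_conv_nth simp flip: \<open>Suc i = length p\<close>)
      qed
    qed (use False p(1) in \<open>auto simp: is_path_def\<close>)
    then show ?thesis using p(2) ne by (intro exI[of _ "p @ [z]"]) simp
  qed
qed

text \<open>Trades simple paths for the reflexive transitive closure, where monotonicity and
  idempotence of \<open>rtrancl\<close> are available.\<close>

lemma tr_iff: "(a, b) \<in> tr E \<longleftrightarrow> a \<noteq> b \<and> (a, b) \<in> E\<^sup>*"
  using is_path_imp_rtrancl rtrancl_imp_is_path by (fastforce simp: tr_def)

section \<open>Witness lists generated by extension with single arcs\<close>

definition pairs :: "witness list \<Rightarrow> arc set" where
  "pairs L = wpair ` set L"

lemma pairs_append [simp]: "pairs (L @ M) = pairs L \<union> pairs M"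
  by (auto simp: pairs_def)

lemma pairs_Nil [simp]: "pairs [] = {}"
  by (simp add: pairs_def)

lemma pairs_single [simp]: "pairs [(a, b, w)] = {(a, b)}"
  by (simp add: pairs_def)

lemma wl_arcs_append [simp]: "wl_arcs (L @ M) = wl_arcs L \<union> wl_arcs M"
  by (auto simp: wl_arcs_def)

lemma wl_arcs_Nil [simp]: "wl_arcs [] = {}"
  by (simp add: wl_arcs_def)

lemma wl_arcs_single [simp]: "wl_arcs [(a, b, w)] = (if w = b then {(a, b)} else {})"
  by (auto simp: wl_arcs_def)

lemma wl_arcs_subset_pairs: "wl_arcs L \<subseteq> pairs L"
  by (force simp: wl_arcs_def pairs_def)

lemma in_pairs_iff: "(a, b) \<in> pairs L \<longleftrightarrow> (\<exists>w. (a, b, w) \<in> set L)"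
  by (force simp: pairs_def)

text \<open>Restricting compositions to an arc as second part is what keeps the walks simple: the walk
  for \<open>(a, w)\<close> only visits nodes already paired with \<open>a\<close>, and \<open>b\<close> is not one of them.\<close>

inductive arcwise :: "node set \<Rightarrow> witness list \<Rightarrow> bool" for V where
  Nil: "arcwise V []"
| arc: "arcwise V L \<Longrightarrow> a \<in> V \<Longrightarrow> b \<in> V \<Longrightarrow> a \<noteq> b \<Longrightarrow> (a, b) \<notin> pairs L
    \<Longrightarrow> arcwise V (L @ [(a, b, b)])"
| comp: "arcwise V L \<Longrightarrow> (a, w) \<in> pairs L \<Longrightarrow> (w, b, b) \<in> set L \<Longrightarrow> a \<noteq> b \<Longrightarrow> (a, b) \<notin> pairs L
    \<Longrightarrow> arcwise V (L @ [(a, b, w)])"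

lemma arcwise_set:
  assumes "arcwise V L"
  shows "set L \<subseteq> V \<times> V \<times> V" and "(a, b, w) \<in> set L \<Longrightarrow> a \<noteq> b"
  using assms by (induction) (auto simp: in_pairs_iff)

lemma arcwise_pairs:
  assumes "arcwise V L" "(a, b) \<in> pairs L"
  shows "a \<in> V" "b \<in> V" "a \<noteq> b"
  using arcwise_set[OF assms(1)] assms(2) by (auto simp: in_pairs_iff)

lemma arcwise_distinct: "arcwise V L \<Longrightarrow> distinct (map wpair L)"
  by (induction rule: arcwise.induct) (auto simp: pairs_def)

lemma arcwise_witness_list:
  assumes "arcwise V L"
  shows "witness_list V L"
proof -
  have "\<exists>j < i. \<exists>k < i. (a, w) = wpair (L ! j) \<and> (w, b) = wpair (L ! k)"
    if "i < length L" "L ! i = (a, b, w)" "w \<noteq> b" for i a b w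
    using assms that
  proof (induction arbitrary: i a b w rule: arcwise.induct)
    case (arc L a b)
    then show ?case by (fastforce simp: nth_append less_Suc_eq split: if_splits)
  next
    case (comp L a' w' b')
    show ?case
    proof (cases "i < length L")
      case True
      with comp.prems have "L ! i = (a, b, w)" by (simp add: nth_append)
      with comp.IH[of i a b w] True comp.prems obtain j k where
        "j < i" "k < i" "(a, w) = wpair (L ! j)" "(w, b) = wpair (L ! k)" by blast
      with True show ?thesis by (intro exI[of _ j] conjI exI[of _ k]) (auto simp: nth_append)
    next
      case False
      with comp.prems have i: "i = length L" and e: "a = a'" "b = b'" "w = w'"
        by (auto simp: nth_append less_Suc_eq)
      from comp.hyps obtain x where "(a', w', x) \<in> set L" by (auto simp: in_pairs_iff)
      then obtain j where j: "j < length L" "L ! j = (a', w', x)" by (auto simp: in_set_conv_nth)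
      from comp.hyps(3) obtain k where k: "k < length L" "L ! k = (w', b', b')"
        by (auto simp: in_set_conv_nth)
      show ?thesis using i e j k
        by (intro exI[of _ j] conjI exI[of _ k]) (auto simp: nth_append)
    qed
  qed simp
  with arcwise_set[OF assms] arcwise_distinct[OF assms] show ?thesis
    unfolding witness_list_def by blast
qed

lemma wl_walk_mono:
  assumes "wl_walk L a b p" "set L \<subseteq> set L'"
  shows "wl_walk L' a b p"
  using assms by (induction) (auto intro: wl_walk.intros)

text \<open>The clause on the nodes of \<open>p\<close> is the strengthening that carries the
  induction: in the \<open>comp\<close> step \<open>(a, b)\<close> is a new pair and
  \<open>a \<noteq> b\<close>, so appending \<open>b\<close> to the walk for \<open>(a, w)\<close>
  keeps it distinct.\<close>

lemma arcwise_walk: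
  assumes "arcwise V L" "(a, b) \<in> pairs L"
  shows "\<exists>p. wl_walk L a b p \<and> distinct p \<and> (\<forall>z \<in> set p. z = a \<or> (a, z) \<in> pairs L)"
  using assms
proof (induction arbitrary: a b rule: arcwise.induct)
  case (arc L a' b')
  show ?case
  proof (cases "(a, b) \<in> pairs L")
    case True
    then obtain p where "wl_walk L a b p" "distinct p" "\<forall>z \<in> set p. z = a \<or> (a, z) \<in> pairs L"
      using arc.IH by blast
    then show ?thesis by (intro exI[of _ p]) (auto intro: wl_walk_mono)
  next
    case False
    with arc.prems have e: "a = a'" "b = b'" by auto
    then have "wl_walk (L @ [(a', b', b')]) a b [a, b]" by (intro wl_walk.arc) simp
    with e arc.hyps show ?thesis by (intro exI[of _ "[a, b]"]) auto
  qed
next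
  case (comp L a' w' b')
  let ?L = "L @ [(a', b', w')]"
  show ?case
  proof (cases "(a, b) \<in> pairs L")
    case True
    then obtain p where "wl_walk L a b p" "distinct p" "\<forall>z \<in> set p. z = a \<or> (a, z) \<in> pairs L"
      using comp.IH by blast
    then show ?thesis by (intro exI[of _ p]) (auto intro: wl_walk_mono)
  next
    case False
    with comp.prems have e: "a = a'" "b = b'" by auto
    obtain p where p: "wl_walk L a w' p" "distinct p" "\<forall>z \<in> set p. z = a \<or> (a, z) \<in> pairs L"
      using comp.IH[OF comp.hyps(2)] e by blast
    have "w' \<noteq> b" using arcwise_set(2)[OF comp.hyps(1) comp.hyps(3)] e by simp
    moreover have "wl_walk ?L w' b [w', b]" using comp.hyps(3) e by (intro wl_walk.arc) simp
    moreover have "wl_walk ?L a w' p" using p(1) by (auto intro: wl_walk_mono)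
    ultimately have "wl_walk ?L a b (p @ tl [w', b])" using e by (intro wl_walk.comp) auto
    moreover have "b \<notin> set p" using p(3) comp.hyps e by auto
    ultimately show ?thesis using p e by (intro exI[of _ "p @ tl [w', b]"]) auto
  qed
qed simp

lemma arcwise_path_structured: "arcwise V L \<Longrightarrow> path_structured L"
  unfolding path_structured_def by (fastforce dest: arcwise_walk simp: in_pairs_iff)

lemma arcwise_sound: "arcwise V L \<Longrightarrow> pairs L \<subseteq> (wl_arcs L)\<^sup>*"
proof (induction rule: arcwise.induct)
  case (arc L a b)
  have "(wl_arcs L)\<^sup>* \<subseteq> (wl_arcs (L @ [(a, b, b)]))\<^sup>*" by (rule rtrancl_mono) auto
  with arc show ?case by auto
next
  case (comp L a w b)
  have "(wl_arcs L)\<^sup>* \<subseteq> (wl_arcs (L @ [(a, b, w)]))\<^sup>*" by (rule rtrancl_mono) auto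
  moreover have "(a, w) \<in> (wl_arcs L)\<^sup>*" "(w, b) \<in> wl_arcs L"
    using comp by (auto simp: wl_arcs_def)
  then have "(a, b) \<in> (wl_arcs L)\<^sup>*" by (rule rtrancl.rtrancl_into_rtrancl)
  ultimately show ?case using comp by auto
qed simp

text \<open>Since \<open>E\<close> lies between \<open>wl_arcs L\<close> and its reflexive
  transitive closure, both have the same closure. It therefore suffices that the pairs are closed
  under appending one witness arc; the other arcs of \<open>E\<close> need no closure
  condition.\<close>

lemma arcwise_complete:
  assumes L: "arcwise V L" and sub: "wl_arcs L \<subseteq> E" "E \<subseteq> pairs L"
    and closed: "\<And>r x y. (r, x) \<in> pairs L \<Longrightarrow> (x, y) \<in> wl_arcs L \<Longrightarrow> r = y \<or> (r, y) \<in> pairs L"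
  shows "pairs L = tr E"
proof -
  have "(wl_arcs L)\<^sup>* = E\<^sup>*"
    using rtrancl_subset[OF sub(1) subset_trans[OF sub(2) arcwise_sound[OF L]]] by simp
  moreover have "a = b \<or> (a, b) \<in> pairs L" if "(a, b) \<in> (wl_arcs L)\<^sup>*" for a b
    using that by (induction rule: rtrancl_induct) (use closed wl_arcs_subset_pairs in blast)+
  ultimately show ?thesis
    using arcwise_sound[OF L] arcwise_pairs(3)[OF L] by (force simp: tr_iff)
qed

section \<open>Counting the rounds of the search\<close>

text \<open>The number of rounds that \<open>propagate\<close> spends on the queue \<open>L\<close>:
  for each entry, one per successor of its second node and one for moving on.\<close>

definition work :: "(node \<Rightarrow> node list) \<Rightarrow> witness list \<Rightarrow> nat" where
  "work A L = (\<Sum>(a, b, w) \<leftarrow> L. Suc (length (A b)))"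

lemma work_append [simp]: "work A (L @ M) = work A L + work A M"
  by (simp add: work_def)

lemma work_mono: "(\<And>x. length (A x) \<le> length (B x)) \<Longrightarrow> work A L \<le> work B L"
  unfolding work_def by (rule sum_list_mono) auto

lemma work_take_Suc:
  "q < length L \<Longrightarrow> L ! q = (a, b, w) \<Longrightarrow> work A (take (Suc q) L) = work A (take q L) + Suc (length (A b))"
  by (simp add: take_Suc_conv_app_nth work_def)

lemma work_take_le: "work A (take q L) \<le> work A L"
  by (metis append_take_drop_id le_add1 work_append)

text \<open>No pair occurs twice, so the sum over entries is at most a sum over
  \<open>V \<times> V\<close>. There each node \<open>b\<close> is met once per root
  \<open>a\<close>, and the out-degrees add up to at most \<open>card E\<close>.\<close>

lemma work_bound:
  assumes L: "arcwise V L" and V: "finite V" and A: "\<And>x. x \<in> V \<Longrightarrow> distinct (A x)"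
    and E: "(SIGMA x:V. set (A x)) \<subseteq> E" "finite E"
  shows "work A L \<le> card V * (card V + card E)"
proof -
  have "work A L = (\<Sum>p \<leftarrow> map wpair L. Suc (length (A (snd p))))"
    unfolding work_def by (simp add: o_def) (rule arg_cong[of _ _ sum_list], auto)
  also have "\<dots> = (\<Sum>p \<in> pairs L. Suc (length (A (snd p))))"
    using arcwise_distinct[OF L] by (simp add: sum_list_distinct_conv_sum_set pairs_def del: map_map)
  also have "\<dots> \<le> (\<Sum>p \<in> V \<times> V. Suc (length (A (snd p))))"
    using V arcwise_pairs[OF L] by (intro sum_mono2) auto
  also have "\<dots> = (\<Sum>a \<in> V. \<Sum>b \<in> V. Suc (card (set (A b))))"
    unfolding sum.cartesian_product using A by (intro sum.cong) (auto simp: distinct_card)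
  also have "\<dots> = card V * (card V + (\<Sum>b \<in> V. card (set (A b))))"
    by (simp add: sum_Suc)
  also have "(\<Sum>b \<in> V. card (set (A b))) = card (SIGMA x:V. set (A x))"
    using V by simp
  also have "\<dots> \<le> card E" using E by (simp add: card_mono)
  finally show ?thesis by simp
qed

lemma arcwise_length:
  assumes "arcwise V L" "finite V"
  shows "length L \<le> (card V)\<^sup>2"
proof -
  have "length L = card (pairs L)"
    using arcwise_distinct[OF assms(1)] by (simp add: pairs_def distinct_card flip: set_map)
  also have "\<dots> \<le> card (V \<times> V)"
    using assms arcwise_pairs[OF assms(1)] by (intro card_mono) auto
  finally show ?thesis by (simp add: power2_eq_square card_cartesian_product)
qed

section \<open>Weakest preconditions with running time\<close>

text \<open>The existential form includes termination; determinism of \<open>exec\<close> turns it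
  into a statement about any given execution (\<open>wp_exec\<close>). Both directions are demanded
  by \<open>is_ITCO\<close>.\<close>

definition wp :: "com \<Rightarrow> (nat \<Rightarrow> state \<Rightarrow> bool) \<Rightarrow> state \<Rightarrow> bool" where
  "wp c Q s \<longleftrightarrow> (\<exists>t s'. exec c s t s' \<and> Q t s')"

lemma wp_exec: "wp c Q s \<Longrightarrow> exec c s t s' \<Longrightarrow> Q t s'"
  unfolding wp_def using exec_deterministic by blast

lemma wp_mono: "wp c P s \<Longrightarrow> (\<And>t s'. P t s' \<Longrightarrow> Q t s') \<Longrightarrow> wp c Q s"
  unfolding wp_def by blast

lemma wp_Skip [simp]: "wp Skip Q s \<longleftrightarrow> Q 1 s"
  unfolding wp_def using exec.Skip by (auto elim: exec_SkipE)

lemma wp_Assign [simp]: "wp (Assign x e) Q s \<longleftrightarrow> Q 1 (set_reg x (aval e s) s)"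
  unfolding wp_def by (metis exec.Assign exec_AssignE)

lemma wp_Write [simp]:
  "wp (Write r i e) Q s \<longleftrightarrow> Q 1 (set_cell (aval r s) (aval i s) (aval e s) s)"
  unfolding wp_def by (metis exec.Write exec_WriteE)

lemma wp_Seq [simp]: "wp (Seq c d) Q s \<longleftrightarrow> wp c (\<lambda>t. wp d (\<lambda>u. Q (t + u))) s"
  unfolding wp_def by (blast intro: exec.Seq elim: exec_SeqE)

lemma wp_Cond [simp]:
  "wp (Cond b c d) Q s \<longleftrightarrow>
     (if bval b s then wp c (\<lambda>t. Q (1 + t)) s else wp d (\<lambda>t. Q (1 + t)) s)"
  unfolding wp_def
  using exec.CondTrue exec.CondFalse by (auto elim!: exec_CondE) (metis plus_1_eq_Suc)+

text \<open>In \<open>I k t s\<close>, \<open>k\<close> counts the iterations done so far and \<open>t\<close> the time spent on them.\<close>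

lemma wp_While:
  assumes "I 0 0 s"
    and bound: "\<And>k t s. I k t s \<Longrightarrow> k \<le> B"
    and step: "\<And>k t s. I k t s \<Longrightarrow> bval b s \<Longrightarrow> wp c (\<lambda>u. I (Suc k) (1 + t + u)) s"
    and exit: "\<And>k t s. I k t s \<Longrightarrow> \<not> bval b s \<Longrightarrow> Q (t + 1) s"
  shows "wp (While b c) Q s"
proof -
  have "wp (While b c) (\<lambda>u. Q (t + u)) s" if "I k t s" for k t s
    using that
  \<comment> \<open>With \<open>Suc B\<close> the measure still decreases strictly in a round that
    starts at \<open>k = B\<close>.\<close>
  proof (induction "Suc B - k" arbitrary: k t s rule: less_induct)
    case less
    show ?case
    proof (cases "bval b s")
      case True
      from step[OF less.prems True] obtain u s' where u: "exec c s u s'" "I (Suc k) (1 + t + u) s'"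
        by (auto simp: wp_def)
      have "wp (While b c) (\<lambda>v. Q (1 + t + u + v)) s'"
        using u(2) bound[OF less.prems] by (intro less.hyps) auto
      then obtain v s'' where v: "exec (While b c) s' v s''" "Q (1 + t + u + v) s''"
        by (auto simp: wp_def)
      have "exec (While b c) s (1 + u + v) s''" using exec.WhileTrue[OF True u(1) v(1)] .
      moreover have "Q (t + (1 + u + v)) s''" using v(2) by (simp add: add_ac)
      ultimately
      show ?thesis unfolding wp_def by blast
    next
      case False
      then show ?thesis using exit[OF less.prems] exec.WhileFalse unfolding wp_def by blast
    qed
  qed
  from this[OF assms(1)] show ?thesis by simp
qed

section \<open>Memory layout\<close>

text \<open>Array 2 holds the nodes, 3 to 5 the witness list, 6 and 7 the arcs, 8 the lengths of the
  successor lists, 9 and 10 the output of \<open>TcCover\<close>; node \<open>x\<close> owns array \<open>20 + 2 * x\<close>, the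
  characteristic function of the nodes reachable from \<open>x\<close>, and array \<open>21 + 2 * x\<close>, its
  successors.\<close>

definition wits :: "state \<Rightarrow> witness list" where
  "wits s = map (\<lambda>i. (mem s 3 i, mem s 4 i, mem s 5 i)) [0..<regs s ''wl_len'']"

definition arcs :: "state \<Rightarrow> arc list" where
  "arcs s = map (\<lambda>i. (mem s 6 i, mem s 7 i)) [0..<regs s ''m'']"

definition succs :: "state \<Rightarrow> node \<Rightarrow> node list" where
  "succs s x = map (mem s (21 + 2 * x)) [0..<mem s 8 x]"

abbreviation reach :: "state \<Rightarrow> node \<Rightarrow> node \<Rightarrow> nat" where
  "reach s a b \<equiv> mem s (20 + 2 * a) b"

abbreviation Reach :: "aexp \<Rightarrow> aexp \<Rightarrow> aexp" where
  "Reach a b \<equiv> Cell (Plus (Const 20) (Times (Const 2) a)) b"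

abbreviation Succs :: "aexp \<Rightarrow> aexp" where
  "Succs a \<equiv> Plus (Const 21) (Times (Const 2) a)"

lemma regs_set_reg [simp]: "regs (set_reg x v s) y = (if y = x then v else regs s y)"
  by (simp add: set_reg_def)

lemma mem_set_reg [simp]: "mem (set_reg x v s) = mem s"
  by (simp add: set_reg_def)

lemma regs_set_cell [simp]: "regs (set_cell r i v s) = regs s"
  by (simp add: set_cell_def)

lemma mem_set_cell [simp]:
  "mem (set_cell r i v s) r' j = (if r' = r \<and> j = i then v else mem s r' j)"
  by (simp add: set_cell_def)

lemma even_row_neq_odd_row [simp]: "20 + 2 * x \<noteq> 21 + 2 * (y :: nat)" "21 + 2 * y \<noteq> 20 + 2 * x"
  by presburger+

lemma length_wits [simp]: "length (wits s) = regs s ''wl_len''"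
  by (simp add: wits_def)

lemma length_arcs [simp]: "length (arcs s) = regs s ''m''"
  by (simp add: arcs_def)

lemma length_succs [simp]: "length (succs s x) = mem s 8 x"
  by (simp add: succs_def)

lemma wits_nth: "i < regs s ''wl_len'' \<Longrightarrow> wits s ! i = (mem s 3 i, mem s 4 i, mem s 5 i)"
  by (simp add: wits_def)

lemma succs_nth: "i < mem s 8 x \<Longrightarrow> succs s x ! i = mem s (21 + 2 * x) i"
  by (simp add: succs_def)

lemma wits_set_reg [simp]: "x \<noteq> ''wl_len'' \<Longrightarrow> wits (set_reg x v s) = wits s"
  by (simp add: wits_def)

lemma arcs_set_reg [simp]: "x \<noteq> ''m'' \<Longrightarrow> arcs (set_reg x v s) = arcs s"
  by (simp add: arcs_def)

lemma succs_set_reg [simp]: "succs (set_reg x v s) = succs s"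
  by (simp add: succs_def fun_eq_iff)

lemma wits_set_cell [simp]: "r \<noteq> 3 \<Longrightarrow> r \<noteq> 4 \<Longrightarrow> r \<noteq> 5 \<Longrightarrow> wits (set_cell r i v s) = wits s"
  by (simp add: wits_def)

lemma arcs_set_cell [simp]: "r \<noteq> 6 \<Longrightarrow> r \<noteq> 7 \<Longrightarrow> arcs (set_cell r i v s) = arcs s"
  by (simp add: arcs_def)

lemma succs_set_cell [simp]: "r < 20 \<Longrightarrow> r \<noteq> 8 \<Longrightarrow> succs (set_cell r i v s) = succs s"
  by (auto simp: succs_def fun_eq_iff)

section \<open>The program\<close>

definition push_wit :: com where
  "push_wit =
     Seq (Write (Const 3) (Reg ''wl_len'') (Reg ''a''))
    (Seq (Write (Const 4) (Reg ''wl_len'') (Reg ''b''))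
    (Seq (Write (Const 5) (Reg ''wl_len'') (Reg ''w''))
    (Seq (Write (Plus (Const 20) (Times (Const 2) (Reg ''a''))) (Reg ''b'') (Const 1))
         (Assign ''wl_len'' (Plus (Reg ''wl_len'') (Const 1))))))"

definition push_arc :: com where
  "push_arc =
     Seq (Write (Const 6) (Reg ''m'') (Reg ''u''))
    (Seq (Write (Const 7) (Reg ''m'') (Reg ''v''))
         (Assign ''m'' (Plus (Reg ''m'') (Const 1))))"

definition push_succ :: com where
  "push_succ =
     Seq (Write (Succs (Reg ''u'')) (Cell (Const 8) (Reg ''u'')) (Reg ''v''))
         (Write (Const 8) (Reg ''u'') (Plus (Cell (Const 8) (Reg ''u'')) (Const 1)))"

definition scan_tails :: com where
  "scan_tails =
    While (Less (Reg ''i'') (Reg ''n''))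
     (Seq (Assign ''a'' (Cell (Const 2) (Reg ''i'')))
     (Seq (Cond (Conj (Equal (Reach (Reg ''a'') (Reg ''w'')) (Const 1))
                      (Equal (Reach (Reg ''a'') (Reg ''b'')) (Const 0)))
            push_wit Skip)
          (Assign ''i'' (Plus (Reg ''i'') (Const 1)))))"

text \<open>A flat loop in place of two nested ones: a round either treats the successor number
  \<open>j\<close> of the entry at \<open>q\<close> or moves on to the next entry. Thus a single
  round counter matches \<open>work\<close>.\<close>

definition propagate :: com where
  "propagate =
    While (Less (Reg ''q'') (Reg ''wl_len''))
     (Seq (Assign ''a'' (Cell (Const 3) (Reg ''q'')))
     (Seq (Assign ''w'' (Cell (Const 4) (Reg ''q'')))
          (Cond (Less (Reg ''j'') (Cell (Const 8) (Reg ''w'')))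
            (Seq (Assign ''b'' (Cell (Succs (Reg ''w'')) (Reg ''j'')))
            (Seq (Cond (Equal (Reach (Reg ''a'') (Reg ''b'')) (Const 0)) push_wit Skip)
                 (Assign ''j'' (Plus (Reg ''j'') (Const 1)))))
            (Seq (Assign ''q'' (Plus (Reg ''q'') (Const 1)))
                 (Assign ''j'' (Const 0))))))"

definition insert_arc :: com where
  "insert_arc =
     Seq push_succ
    (Seq (Assign ''q'' (Reg ''wl_len''))
    (Seq (Assign ''a'' (Reg ''u''))
    (Seq (Assign ''b'' (Reg ''v''))
    (Seq (Assign ''w'' (Reg ''v''))
    (Seq push_wit
    (Seq (Assign ''w'' (Reg ''u''))
    (Seq (Assign ''i'' (Const 0))
    (Seq scan_tails
    (Seq (Assign ''j'' (Const 0))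
         propagate)))))))))"

definition add_arc :: com where
  "add_arc =
     Seq (Assign ''u'' (Cell (Const 0) (Reg ''k'')))
    (Seq (Assign ''v'' (Cell (Const 1) (Reg ''k'')))
    (Seq (Assign ''k'' (Plus (Reg ''k'') (Const 1)))
    (Seq push_arc
         (Cond (Equal (Reach (Reg ''u'') (Reg ''v'')) (Const 0)) insert_arc Skip))))"

definition add_prog :: com where
  "add_prog =
     Seq (Assign ''k'' (Const 0))
         (While (Less (Reg ''k'') (Reg ''len'')) add_arc)"

definition next_pair :: com where
  "next_pair =
     Seq (Assign ''j'' (Plus (Reg ''j'') (Const 1)))
         (Cond (Less (Reg ''j'') (Reg ''len'')) Skip
           (Seq (Assign ''i'' (Plus (Reg ''i'') (Const 1)))
                (Assign ''j'' (Const 0))))"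

text \<open>As nothing is known about the initial memory, every table cell with both indices in the
  node set is written. With truncated subtraction, \<open>1 - ((a - b) + (b - a))\<close> is 1 if
  \<open>a = b\<close> and 0 otherwise.\<close>

definition init_loop :: com where
  "init_loop =
    While (Less (Reg ''i'') (Reg ''len''))
      (Seq (Assign ''a'' (Cell (Const 0) (Reg ''i'')))
      (Seq (Assign ''b'' (Cell (Const 0) (Reg ''j'')))
      (Seq (Write (Const 2) (Reg ''i'') (Reg ''a''))
      (Seq (Write (Const 8) (Reg ''a'') (Const 0))
      (Seq (Write (Plus (Const 20) (Times (Const 2) (Reg ''a''))) (Reg ''b'')
             (Minus (Const 1) (Plus (Minus (Reg ''a'') (Reg ''b''))
                                    (Minus (Reg ''b'') (Reg ''a'')))))
           next_pair)))))"

definition init_prog :: com where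
  "init_prog =
     Seq (Assign ''n'' (Reg ''len''))
    (Seq (Assign ''m'' (Const 0))
    (Seq (Assign ''wl_len'' (Const 0))
    (Seq (Assign ''i'' (Const 0))
    (Seq (Assign ''j'' (Const 0))
         init_loop))))"

definition push_out :: com where
  "push_out =
     Seq (Write (Const 9) (Reg ''arcs_len'') (Reg ''a''))
    (Seq (Write (Const 10) (Reg ''arcs_len'') (Reg ''b''))
         (Assign ''arcs_len'' (Plus (Reg ''arcs_len'') (Const 1))))"

definition cover_loop :: com where
  "cover_loop =
    While (Less (Reg ''i'') (Reg ''len''))
      (Seq (Assign ''a'' (Cell (Const 0) (Reg ''i'')))
      (Seq (Assign ''b'' (Cell (Const 0) (Reg ''j'')))
      (Seq (Cond (Conj (Equal (Reach (Reg ''a'') (Reg ''b'')) (Const 1))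
                       (Neg (Equal (Reg ''a'') (Reg ''b''))))
             push_out
             Skip)
           next_pair)))"

text \<open>The nodes of the cover are returned as the argument array 0 itself, which still contains
  \<open>S\<close> at the end of the call.\<close>

definition cover_pairs :: com where
  "cover_pairs =
     Seq (Assign ''nodes'' (Const 0))
    (Seq (Assign ''nodes_len'' (Reg ''len''))
    (Seq (Assign ''tails'' (Const 9))
    (Seq (Assign ''heads'' (Const 10))
    (Seq (Assign ''arcs_len'' (Const 0))
    (Seq (Assign ''i'' (Const 0))
    (Seq (Assign ''j'' (Const 0))
         cover_loop))))))"

definition cover_all :: com where
  "cover_all =
     Seq (Assign ''nodes'' (Const 2))
    (Seq (Assign ''nodes_len'' (Reg ''n''))
    (Seq (Assign ''tails'' (Const 6))
    (Seq (Assign ''heads'' (Const 7))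
         (Assign ''arcs_len'' (Reg ''m'')))))"

definition cover_prog :: com where
  "cover_prog = Cond (Less (Reg ''m'') (Times (Reg ''len'') (Reg ''len''))) cover_all cover_pairs"

definition witlist_prog :: com where
  "witlist_prog =
     Seq (Assign ''wl_a'' (Const 3))
    (Seq (Assign ''wl_b'' (Const 4))
         (Assign ''wl_w'' (Const 5)))"

definition bfs_itco :: itco where
  "bfs_itco = \<lparr>init_code = init_prog, add_code = add_prog, cover_code = cover_prog,
     witlist_code = witlist_prog\<rparr>"

section \<open>Adding arcs\<close>

text \<open>The straight-line fragments become state transformers, so that later proofs see their
  effect only on \<open>wits\<close>, \<open>arcs\<close>, \<open>succs\<close> and
  \<open>reach\<close>, not on single cells.\<close>

definition put_wit :: "state \<Rightarrow> state" where
  "put_wit s = set_reg ''wl_len'' (regs s ''wl_len'' + 1)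
     (set_cell (20 + 2 * regs s ''a'') (regs s ''b'') 1
     (set_cell 5 (regs s ''wl_len'') (regs s ''w'')
     (set_cell 4 (regs s ''wl_len'') (regs s ''b'')
     (set_cell 3 (regs s ''wl_len'') (regs s ''a'') s))))"

definition put_arc :: "state \<Rightarrow> state" where
  "put_arc s = set_reg ''m'' (regs s ''m'' + 1)
     (set_cell 7 (regs s ''m'') (regs s ''v'') (set_cell 6 (regs s ''m'') (regs s ''u'') s))"

definition put_succ :: "state \<Rightarrow> state" where
  "put_succ s = set_cell 8 (regs s ''u'') (mem s 8 (regs s ''u'') + 1)
     (set_cell (21 + 2 * regs s ''u'') (mem s 8 (regs s ''u'')) (regs s ''v'') s)"

lemma wp_push_wit [simp]: "wp push_wit Q s \<longleftrightarrow> Q 5 (put_wit s)"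
  by (simp add: push_wit_def put_wit_def eval_nat_numeral)

lemma wp_push_arc [simp]: "wp push_arc Q s \<longleftrightarrow> Q 3 (put_arc s)"
  by (simp add: push_arc_def put_arc_def eval_nat_numeral)

lemma wp_push_succ [simp]: "wp push_succ Q s \<longleftrightarrow> Q 2 (put_succ s)"
  by (simp add: push_succ_def put_succ_def eval_nat_numeral)

lemma put_wit_simps [simp]:
  "regs (put_wit s) z = (if z = ''wl_len'' then Suc (regs s z) else regs s z)"
  "r < 3 \<Longrightarrow> mem (put_wit s) r = mem s r"
  "mem (put_wit s) 8 = mem s 8"
  "reach (put_wit s) x y = (if x = regs s ''a'' \<and> y = regs s ''b'' then 1 else reach s x y)"
  "wits (put_wit s) = wits s @ [(regs s ''a'', regs s ''b'', regs s ''w'')]"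
  "arcs (put_wit s) = arcs s"
  "succs (put_wit s) = succs s"
  by (auto simp: put_wit_def wits_def arcs_def succs_def fun_eq_iff)

lemma put_arc_simps [simp]:
  "regs (put_arc s) z = (if z = ''m'' then Suc (regs s z) else regs s z)"
  "r < 6 \<Longrightarrow> mem (put_arc s) r = mem s r"
  "mem (put_arc s) 8 = mem s 8"
  "reach (put_arc s) x = reach s x"
  "wits (put_arc s) = wits s"
  "arcs (put_arc s) = arcs s @ [(regs s ''u'', regs s ''v'')]"
  "succs (put_arc s) = succs s"
  by (auto simp: put_arc_def wits_def arcs_def succs_def fun_eq_iff)

lemma put_succ_simps [simp]:
  "regs (put_succ s) = regs s"
  "r < 8 \<Longrightarrow> mem (put_succ s) r = mem s r"
  "reach (put_succ s) x = reach s x"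
  "wits (put_succ s) = wits s"
  "arcs (put_succ s) = arcs s"
  "succs (put_succ s) = (succs s)(regs s ''u'' := succs s (regs s ''u'') @ [regs s ''v''])"
  by (auto simp: put_succ_def wits_def arcs_def succs_def fun_eq_iff)

section \<open>Invariants of the search\<close>

text \<open>Holds also in the middle of a search, when pairs are still missing. The diagonal of the
  table is 1, so the single test for 0 excludes both known pairs and pairs \<open>(r, r)\<close>.
  The successor lists represent exactly the arcs of the witness list, whereas \<open>arcs\<close>
  may contain more.\<close>

definition wf_state :: "node list \<Rightarrow> state \<Rightarrow> bool" where
  "wf_state Vs s \<longleftrightarrow>
     regs s ''n'' = length Vs \<and> (\<forall>i < length Vs. mem s 2 i = Vs ! i) \<and>
     (\<forall>a \<in> set Vs. \<forall>b \<in> set Vs. reach s a b = (if a = b \<or> (a, b) \<in> pairs (wits s) then 1 else 0)) \<and>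
     arcwise (set Vs) (wits s) \<and> (\<forall>x \<in> set Vs. distinct (succs s x)) \<and>
     wl_arcs (wits s) = (SIGMA x:set Vs. set (succs s x)) \<and> wl_arcs (wits s) \<subseteq> set (arcs s) \<and>
     distinct (arcs s) \<and> set (arcs s) \<subseteq> set Vs \<times> set Vs \<and> (\<forall>(a, b) \<in> set (arcs s). a \<noteq> b)"

definition closed_at :: "state \<Rightarrow> node \<Rightarrow> node \<Rightarrow> bool" where
  "closed_at s r x \<longleftrightarrow> (\<forall>y \<in> set (succs s x). r = y \<or> (r, y) \<in> pairs (wits s))"

text \<open>The invariant between insertions; during a search it fails until the queue is
  exhausted.\<close>

definition closed_state :: "node list \<Rightarrow> state \<Rightarrow> bool" where
  "closed_state Vs s \<longleftrightarrow> wf_state Vs s \<and> set (arcs s) \<subseteq> pairs (wits s) \<and>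
     (\<forall>(r, x) \<in> pairs (wits s). closed_at s r x)"

text \<open>The total number of steps that the queue has taken once all entries are processed, measured
  with the current successor lists; it pays for the search.\<close>

definition potential :: "state \<Rightarrow> nat" where
  "potential s = work (succs s) (wits s)"

text \<open>What a search loop leaves alone: arrays 0 and 1 hold arcs still to be inserted, fixed
  \<open>succs\<close> and \<open>arcs\<close> keep the measure and its bound stable, and a queue
  that is only extended loses no pair.\<close>

definition frame :: "reg set \<Rightarrow> state \<Rightarrow> state \<Rightarrow> bool" where
  "frame X s s' \<longleftrightarrow> mem s' 0 = mem s 0 \<and> mem s' 1 = mem s 1 \<and> (\<forall>x \<in> X. regs s' x = regs s x) \<and>
     succs s' = succs s \<and> arcs s' = arcs s \<and> (\<exists>M. wits s' = wits s @ M)"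

lemma frame_refl [simp]: "frame X s s"
  by (simp add: frame_def)

lemma frame_set_reg [simp]:
  "x \<notin> X \<Longrightarrow> x \<noteq> ''m'' \<Longrightarrow> x \<noteq> ''wl_len'' \<Longrightarrow> frame X s (set_reg x v s') \<longleftrightarrow> frame X s s'"
  unfolding frame_def by auto

lemma frame_put_wit: "''wl_len'' \<notin> X \<Longrightarrow> frame X s s' \<Longrightarrow> frame X s (put_wit s')"
  unfolding frame_def by auto

lemma wf_state_set_reg [simp]:
  "x \<noteq> ''n'' \<Longrightarrow> x \<noteq> ''m'' \<Longrightarrow> x \<noteq> ''wl_len'' \<Longrightarrow> wf_state Vs (set_reg x v s) \<longleftrightarrow> wf_state Vs s"
  by (simp add: wf_state_def)

lemma wf_state_reach:
  "wf_state Vs s \<Longrightarrow> a \<in> set Vs \<Longrightarrow> b \<in> set Vs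
    \<Longrightarrow> reach s a b = (if a = b \<or> (a, b) \<in> pairs (wits s) then 1 else 0)"
  by (simp add: wf_state_def)

lemma wf_state_put_wit:
  assumes "wf_state Vs s" "(regs s ''a'', regs s ''w'') \<in> pairs (wits s)"
    "(regs s ''w'', regs s ''b'', regs s ''b'') \<in> set (wits s)"
    "regs s ''a'' \<noteq> regs s ''b''" "(regs s ''a'', regs s ''b'') \<notin> pairs (wits s)"
  shows "wf_state Vs (put_wit s)"
proof -
  have L: "arcwise (set Vs) (wits s)" using assms(1) by (simp add: wf_state_def)
  have "regs s ''w'' \<noteq> regs s ''b''" using arcwise_set(2)[OF L assms(3)] .
  moreover have "arcwise (set Vs) (wits s @ [(regs s ''a'', regs s ''b'', regs s ''w'')])"
    using L assms(2-5) by (rule arcwise.comp)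
  ultimately show ?thesis using assms(1,4) unfolding wf_state_def by simp blast
qed

lemma wf_state_potential:
  assumes "wf_state Vs s"
  shows "potential s \<le> card (set Vs) * (card (set Vs) + card (set (arcs s)))"
  unfolding potential_def
  using assms by (intro work_bound) (auto simp: wf_state_def)

lemma closed_at_set_reg [simp]: "x \<noteq> ''wl_len'' \<Longrightarrow> closed_at (set_reg x v s) = closed_at s"
  by (simp add: closed_at_def fun_eq_iff)

lemma closed_at_put_wit: "closed_at s r x \<Longrightarrow> closed_at (put_wit s) r x"
  by (auto simp: closed_at_def)

section \<open>The two search loops\<close>

text \<open>The entries appended here end in \<open>v \<noteq> u\<close>, so no new pair
  \<open>(r, u)\<close> arises and the nodes already scanned stay settled. The roots
  \<open>u\<close> and \<open>v\<close> are passed over, as their table cells for \<open>v\<close>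
  are already 1. A round takes at most 9 steps, five of them in \<open>push_wit\<close>.\<close>

lemma wp_scan_tails:
  assumes s: "wf_state Vs s" "regs s ''i'' = 0" "regs s ''w'' = u" "regs s ''b'' = v"
    and uv: "(u, v, v) \<in> set (wits s)"
  shows "wp scan_tails (\<lambda>t s'. wf_state Vs s' \<and> frame {''len'', ''k'', ''q''} s s' \<and>
     t \<le> 9 * length Vs + 1 \<and>
     (\<forall>r. (r, u) \<in> pairs (wits s') \<longrightarrow> r = v \<or> (r, v) \<in> pairs (wits s'))) s"
  unfolding scan_tails_def
proof (rule wp_While[where B = "length Vs" and I = "\<lambda>k t s'. wf_state Vs s' \<and>
    frame {''len'', ''k'', ''q''} s s' \<and> t \<le> 9 * k \<and> regs s' ''i'' = k \<and> k \<le> length Vs \<and>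
    regs s' ''w'' = u \<and> regs s' ''b'' = v \<and>
    (\<forall>i < k. (Vs ! i, u) \<in> pairs (wits s') \<longrightarrow> Vs ! i = v \<or> (Vs ! i, v) \<in> pairs (wits s'))"],
    goal_cases)
  case 1
  with s show ?case by simp
next
  case (2 k t s')
  then show ?case by simp
next
  case (3 k t s')
  from 3 have wf: "wf_state Vs s'" and k: "k < length Vs" "mem s' 2 k = Vs ! k"
    by (auto simp: wf_state_def)
  have uv': "(u, v, v) \<in> set (wits s')" using 3 uv by (auto simp: frame_def)
  have L: "arcwise (set Vs) (wits s')" using wf by (simp add: wf_state_def)
  have V: "u \<in> set Vs" "v \<in> set Vs" "Vs ! k \<in> set Vs" "u \<noteq> v"
    using arcwise_set[OF L] uv' k by auto
  have vw: "(u, v) \<in> pairs (wits s')" using uv' by (auto simp: in_pairs_iff)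
  show ?case
    using 3 k V vw wf_state_reach[OF wf V(3) V(1)] wf_state_reach[OF wf V(3) V(2)] uv'
    by (auto simp: less_Suc_eq intro!: frame_put_wit wf_state_put_wit split: if_splits)
next
  case (4 k t s')
  then have wf: "wf_state Vs s'" and k: "k = length Vs"
    by (auto simp: wf_state_def)
  then have L: "arcwise (set Vs) (wits s')" by (simp add: wf_state_def)
  show ?case using 4 k arcwise_pairs[OF L] by (auto simp: in_set_conv_nth) 
     (metis in_set_conv_nth)+
qed

text \<open>Each round takes at most 12 steps and raises the work of the processed prefix plus
  \<open>j\<close> by exactly one. The prefix before the initial \<open>q\<close> is assumed closed,
  and its work is not paid again.\<close>

lemma wp_propagate:
  assumes s: "wf_state Vs s" "regs s ''j'' = 0" "regs s ''q'' \<le> regs s ''wl_len''"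
    and closed: "\<And>i r x w. i < regs s ''q'' \<Longrightarrow> wits s ! i = (r, x, w) \<Longrightarrow> closed_at s r x"
  shows "wp propagate (\<lambda>t s'. wf_state Vs s' \<and> frame {''len'', ''k''} s s' \<and>
     t + 12 * work (succs s) (take (regs s ''q'') (wits s)) \<le> 12 * potential s' + 1 \<and>
     (\<forall>(r, x) \<in> pairs (wits s'). closed_at s' r x)) s"
  unfolding propagate_def
\<comment> \<open>The queue grows during the loop, so \<open>potential\<close> of the current state
  is no fixed bound; \<open>B\<close> bounds it in every well-formed state with the same arcs. That
  \<open>j\<close> is 0 once the queue is exhausted turns the counting equation into
  \<open>potential\<close> at the exit.\<close>
proof (rule wp_While[where B = "card (set Vs) * (card (set Vs) + card (set (arcs s)))" and
    I = "\<lambda>k t s'. wf_state Vs s' \<and> frame {''len'', ''k''} s s' \<and> t \<le> 12 * k \<and>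
      regs s' ''q'' \<le> regs s' ''wl_len'' \<and>
      (regs s' ''q'' = regs s' ''wl_len'' \<longrightarrow> regs s' ''j'' = 0) \<and>
      (\<forall>r x w. regs s' ''q'' < regs s' ''wl_len'' \<and> wits s' ! regs s' ''q'' = (r, x, w) \<longrightarrow>
         regs s' ''j'' \<le> length (succs s' x) \<and>
         (\<forall>j < regs s' ''j''. r = succs s' x ! j \<or> (r, succs s' x ! j) \<in> pairs (wits s'))) \<and>
      (\<forall>i < regs s' ''q''. \<forall>r x w. wits s' ! i = (r, x, w) \<longrightarrow> closed_at s' r x) \<and>
      k + work (succs s) (take (regs s ''q'') (wits s)) =
        work (succs s') (take (regs s' ''q'') (wits s')) + regs s' ''j''"],
    goal_cases)
  case 1
  with s closed show ?case by auto
next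
  case (2 k t s')
  have "k \<le> potential s'"
  proof (cases "regs s' ''q'' < regs s' ''wl_len''")
    case True
    obtain r x w where "wits s' ! regs s' ''q'' = (r, x, w)" by (metis prod_cases3)
    with 2 True have "k \<le> work (succs s') (take (Suc (regs s' ''q'')) (wits s'))"
      by (auto simp: work_take_Suc)
    then show ?thesis using work_take_le le_trans unfolding potential_def by blast
  next
    case False
    with 2 show ?thesis by (auto simp: potential_def)
  qed
  also have "\<dots> \<le> card (set Vs) * (card (set Vs) + card (set (arcs s')))"
    using 2 by (intro wf_state_potential) blast
  finally show ?case using 2 by (simp add: frame_def)
next
  case (3 k t s')
  let ?q = "regs s' ''q''"
  let ?j = "regs s' ''j''"
  from 3 have wf: "wf_state Vs s'" and q: "?q < regs s' ''wl_len''" by auto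
  define r x w where "r = mem s' 3 ?q" and "x = mem s' 4 ?q" and "w = mem s' 5 ?q"
  have e: "wits s' ! ?q = (r, x, w)" using q by (simp add: wits_nth r_def x_def w_def)
  then have rx: "(r, x, w) \<in> set (wits s')" using q by (metis length_wits nth_mem)
  have L: "arcwise (set Vs) (wits s')" using wf by (simp add: wf_state_def)
  have V: "r \<in> set Vs" "x \<in> set Vs" "r \<noteq> x" using arcwise_set[OF L] rx by auto
  have j: "?j \<le> length (succs s' x)"
    "\<And>j. j < ?j \<Longrightarrow> r = succs s' x ! j \<or> (r, succs s' x ! j) \<in> pairs (wits s')"
    using 3 q e by blast+
  have fr: "frame {''len'', ''k''} s s'" and t: "t \<le> 12 * k"
    and c: "\<And>i r x w. i < ?q \<Longrightarrow> wits s' ! i = (r, x, w) \<Longrightarrow> closed_at s' r x"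
    and k: "k + work (succs s) (take (regs s ''q'') (wits s)) =
        work (succs s') (take ?q (wits s')) + ?j"
    using 3 by blast+
  show ?case
  proof (cases "?j < mem s' 8 x")
    case True
    define y where "y = mem s' (21 + 2 * x) ?j"
    have y: "succs s' x ! ?j = y" using True by (simp add: succs_nth y_def)
    then have "y \<in> set (succs s' x)" using True nth_mem[of ?j "succs s' x"] by simp
    then have "(x, y) \<in> wl_arcs (wits s')" using wf V by (simp add: wf_state_def)
    then have xy: "(x, y, y) \<in> set (wits s')" by (simp add: wl_arcs_def)
    then have "y \<in> set Vs" using arcwise_set[OF L] by auto
    note reach = wf_state_reach[OF wf V(1) this]
    let ?s = "set_reg ''b'' y (set_reg ''w'' x (set_reg ''a'' r s'))"
    show ?thesis
    proof (cases "reach s' r y = 0")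
      case new: True
      then have ry: "r \<noteq> y" "(r, y) \<notin> pairs (wits s')" using reach by (auto split: if_splits)
      have "wf_state Vs (put_wit ?s)"
        using wf rx xy ry by (intro wf_state_put_wit) (auto simp: in_pairs_iff)
      moreover have "frame {''len'', ''k''} s (put_wit ?s)"
        using fr by (intro frame_put_wit) auto
      moreover have "closed_at (put_wit ?s) r' x'" if "closed_at s' r' x'" for r' x'
        using that by (intro closed_at_put_wit) simp
      ultimately show ?thesis
        using True new q t e y j c k
        by (auto simp: nth_append less_Suc_eq r_def[symmetric] x_def[symmetric] y_def[symmetric]
            simp del: put_wit_simps(2))
    next
      case old: False
      then have "r = y \<or> (r, y) \<in> pairs (wits s')" using reach by (auto split: if_splits)
      then show ?thesis
        using True old q t e y j c k wf fr
        by (auto simp: less_Suc_eq r_def[symmetric] x_def[symmetric] y_def[symmetric])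
    qed
  next
    case False
    with j(1) have "?j = length (succs s' x)" by simp
    with j(2) have "closed_at s' r x" unfolding closed_at_def all_set_conv_all_nth by simp
    \<comment> \<open>The prefix gains \<open>Suc (length (succs s' x))\<close> while
      \<open>j\<close> drops from that length to 0: a net change of one, for this round.\<close>
    then show ?thesis
      using False q t e j c k wf fr work_take_Suc[of ?q "wits s'" r x w "succs s'"]
      by (auto simp: less_Suc_eq r_def[symmetric] x_def[symmetric])
  qed
next
  case (4 k t s')
  then have q: "regs s' ''q'' = regs s' ''wl_len''" "regs s' ''j'' = 0" by auto
  have "closed_at s' r x" if "(r, x) \<in> pairs (wits s')" for r x
    using that 4 q by (auto simp: in_pairs_iff in_set_conv_nth)
  moreover have "k + work (succs s) (take (regs s ''q'') (wits s)) = potential s'"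
    using 4 q by (simp add: potential_def)
  ultimately show ?case using 4 by auto
qed

lemma closed_at_succs:
  assumes "wf_state Vs s" "(r, x) \<in> pairs (wits s)"
  shows "closed_at s r x \<longleftrightarrow> (\<forall>y. (x, y) \<in> wl_arcs (wits s) \<longrightarrow> r = y \<or> (r, y) \<in> pairs (wits s))"
proof -
  have "arcwise (set Vs) (wits s)" using assms(1) by (simp add: wf_state_def)
  then have "x \<in> set Vs" using assms(2) arcwise_pairs(2) by blast
  then show ?thesis using assms(1) by (auto simp: closed_at_def wf_state_def)
qed

text \<open>The search closes the pairs only along witness arcs. The recorded arcs that it ignores
  are covered because \<open>closed_state\<close> makes them pairs.\<close>

lemma closed_state_pairs:
  assumes "closed_state Vs s"
  shows "pairs (wits s) = tr (set (arcs s))"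
proof (rule arcwise_complete)
  have wf: "wf_state Vs s" using assms by (simp add: closed_state_def)
  then show "arcwise (set Vs) (wits s)" "wl_arcs (wits s) \<subseteq> set (arcs s)"
    unfolding wf_state_def by blast+
  show "set (arcs s) \<subseteq> pairs (wits s)" using assms by (simp add: closed_state_def)
  fix r x y assume "(r, x) \<in> pairs (wits s)" "(x, y) \<in> wl_arcs (wits s)"
  with assms closed_at_succs[OF wf] show "r = y \<or> (r, y) \<in> pairs (wits s)"
    unfolding closed_state_def by blast
qed

definition extends :: "state \<Rightarrow> state \<Rightarrow> bool" where
  "extends s s' \<longleftrightarrow> (\<exists>M. wits s' = wits s @ M)"

lemma extends_refl [simp]: "extends s s"
  by (simp add: extends_def)

lemma extends_trans [trans]: "extends s s' \<Longrightarrow> extends s' s'' \<Longrightarrow> extends s s''"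
  unfolding extends_def by auto

definition same_args :: "state \<Rightarrow> state \<Rightarrow> bool" where
  "same_args s s' \<longleftrightarrow> mem s' 0 = mem s 0 \<and> mem s' 1 = mem s 1 \<and> regs s' ''len'' = regs s ''len'' \<and>
     regs s' ''k'' = regs s ''k''"

lemma closed_state_set_reg [simp]:
  "x \<noteq> ''n'' \<Longrightarrow> x \<noteq> ''m'' \<Longrightarrow> x \<noteq> ''wl_len'' \<Longrightarrow> closed_state Vs (set_reg x v s) \<longleftrightarrow> closed_state Vs s"
  by (simp add: closed_state_def)

lemma extends_set_reg [simp]:
  "x \<noteq> ''wl_len'' \<Longrightarrow> extends s (set_reg x v s') \<longleftrightarrow> extends s s'"
  "x \<noteq> ''wl_len'' \<Longrightarrow> extends (set_reg x v s) s' \<longleftrightarrow> extends s s'"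
  by (simp_all add: extends_def)

lemma potential_set_reg [simp]: "x \<noteq> ''wl_len'' \<Longrightarrow> potential (set_reg x v s) = potential s"
  by (simp add: potential_def)

section \<open>Amortised cost of insertions\<close>

text \<open>The program starts in \<open>put_arc s\<close>, which is not closed: the arc is recorded
  but not yet a pair. Hence the invariant is assumed for \<open>s\<close>. The 16 consists of 13
  steps before \<open>scan_tails\<close>, the assignment to \<open>j\<close> and the final tests of
  the two loops.\<close>

lemma wp_insert_arc:
  assumes inv: "closed_state Vs s" and uv: "regs s ''u'' = u" "regs s ''v'' = v"
    and V: "u \<in> set Vs" "v \<in> set Vs" "u \<noteq> v"
    and new: "(u, v) \<notin> set (arcs s)" "(u, v) \<notin> pairs (wits s)"
  shows "wp insert_arc (\<lambda>t s'. closed_state Vs s' \<and> arcs s' = arcs s @ [(u, v)] \<and> extends s s' \<and>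
     same_args s s' \<and> t + 12 * potential s \<le> 12 * potential s' + 9 * length Vs + 16) (put_arc s)"
proof -
  have wf: "wf_state Vs s" and L: "arcwise (set Vs) (wits s)"
    using inv by (auto simp: closed_state_def wf_state_def)
  have vs: "v \<notin> set (succs s u)"
  proof
    assume "v \<in> set (succs s u)"
    then have "(u, v) \<in> wl_arcs (wits s)" using wf V by (simp add: wf_state_def)
    then show False using new wl_arcs_subset_pairs by blast
  qed
  \<comment> \<open>The old end of the queue, where the entry of \<open>(u, v)\<close> will stand;
    the search resumes there.\<close>
  define q where "q = regs s ''wl_len''"
  define s1 where "s1 = set_reg ''i'' 0 (set_reg ''w'' u (put_wit (set_reg ''w'' v (set_reg ''b'' v
    (set_reg ''a'' u (set_reg ''q'' q (put_succ (put_arc s))))))))"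
  have wits1: "wits s1 = wits s @ [(u, v, v)]" by (simp add: s1_def)
  have arcs1: "arcs s1 = arcs s @ [(u, v)]" by (simp add: s1_def uv)
  have succs1: "succs s1 = (succs s)(u := succs s u @ [v])" by (simp add: s1_def uv)
  have args1: "same_args s s1" by (simp add: s1_def same_args_def)
  have q1: "regs s1 ''q'' = q" by (simp add: s1_def)
  have wf1: "wf_state Vs s1"
    unfolding wf_state_def wits1 arcs1 succs1
  proof (intro conjI)
    show "regs s1 ''n'' = length Vs" "\<forall>i < length Vs. mem s1 2 i = Vs ! i"
      using wf by (auto simp: s1_def wf_state_def)
    show "\<forall>a \<in> set Vs. \<forall>b \<in> set Vs.
        reach s1 a b = (if a = b \<or> (a, b) \<in> pairs (wits s @ [(u, v, v)]) then 1 else 0)"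
      using wf_state_reach[OF wf] V by (auto simp: s1_def)
    show "arcwise (set Vs) (wits s @ [(u, v, v)])" using L V new by (intro arcwise.arc)
    show "\<forall>x \<in> set Vs. distinct (((succs s)(u := succs s u @ [v])) x)"
      using wf vs by (auto simp: wf_state_def)
    show "wl_arcs (wits s @ [(u, v, v)]) =
        (SIGMA x:set Vs. set (((succs s)(u := succs s u @ [v])) x))"
      using wf V by (auto simp: wf_state_def split: if_splits)
    show "wl_arcs (wits s @ [(u, v, v)]) \<subseteq> set (arcs s @ [(u, v)])"
      using wf by (auto simp: wf_state_def)
    show "distinct (arcs s @ [(u, v)])" "set (arcs s @ [(u, v)]) \<subseteq> set Vs \<times> set Vs"
      "\<forall>(a, b) \<in> set (arcs s @ [(u, v)]). a \<noteq> b"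
      using wf V new by (auto simp: wf_state_def)
  qed
  have "wp scan_tails (\<lambda>t s'. wf_state Vs s' \<and> frame {''len'', ''k'', ''q''} s1 s' \<and>
     t \<le> 9 * length Vs + 1 \<and>
     (\<forall>r. (r, u) \<in> pairs (wits s') \<longrightarrow> r = v \<or> (r, v) \<in> pairs (wits s'))) s1"
    by (intro wp_scan_tails wf1) (simp_all add: s1_def)
  then have "wp scan_tails (\<lambda>t. wp (Seq (Assign ''j'' (Const 0)) propagate)
     (\<lambda>t' s'. closed_state Vs s' \<and> arcs s' = arcs s @ [(u, v)] \<and> extends s s' \<and>
     same_args s s' \<and> t + t' + 12 * potential s \<le> 12 * potential s' + 9 * length Vs + 3)) s1"
  proof (rule wp_mono, elim conjE)
    fix t2 s2
    assume wf2: "wf_state Vs s2" and f2: "frame {''len'', ''k'', ''q''} s1 s2"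
      and t2: "t2 \<le> 9 * length Vs + 1"
      and tails: "\<forall>r. (r, u) \<in> pairs (wits s2) \<longrightarrow> r = v \<or> (r, v) \<in> pairs (wits s2)"
    let ?s = "set_reg ''j'' 0 s2"
    obtain M where M: "wits s2 = wits s @ (u, v, v) # M" using f2 wits1 by (auto simp: frame_def)
    have q2: "regs s2 ''q'' = q" using f2 q1 by (simp add: frame_def)
    have arcs2: "arcs s2 = arcs s @ [(u, v)]" and succs2: "succs s2 = (succs s)(u := succs s u @ [v])"
      using f2 arcs1 succs1 by (auto simp: frame_def)
    have q_le: "q \<le> length (wits s2)" using M by (simp add: q_def flip: length_wits)
    have take_q: "take q (wits s2) = wits s" using M by (simp add: q_def)
    \<comment> \<open>An old entry was closed in \<open>s\<close>, and only the list of
      \<open>u\<close> has changed. For \<open>x = u\<close> the additional successor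
      \<open>v\<close> has been dealt with by \<open>scan_tails\<close>.\<close>
    have closed: "closed_at ?s r x" if "i < regs ?s ''q''" "wits ?s ! i = (r, x, w)" for i r x w
    proof -
      have "wits s ! i = (r, x, w)" "i < length (wits s)"
        using that M q2 by (auto simp: nth_append q_def)
      then have "(r, x, w) \<in> set (wits s)" by (metis nth_mem)
      then have rx: "(r, x) \<in> pairs (wits s)" by (auto simp: in_pairs_iff)
      then have "closed_at s r x" using inv by (auto simp: closed_state_def)
      moreover have "r = v \<or> (r, v) \<in> pairs (wits s2)" if "x = u"
        using that tails rx M by simp
      ultimately show ?thesis
        unfolding closed_at_def by (auto simp: M succs2)
    qed
    have "wp propagate (\<lambda>t s'. wf_state Vs s' \<and> frame {''len'', ''k''} ?s s' \<and>
        t + 12 * work (succs ?s) (take (regs ?s ''q'') (wits ?s)) \<le> 12 * potential s' + 1 \<and>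
        (\<forall>(r, x) \<in> pairs (wits s'). closed_at s' r x)) ?s"
      using wf2 q2 q_le by (intro wp_propagate closed) simp_all
    \<comment> \<open>Successor lists only grow, so the old queue weighs at least as much under the
      new lists; this makes the bounds telescope.\<close>
    moreover have "potential s \<le> work (succs ?s) (take (regs ?s ''q'') (wits ?s))"
      unfolding potential_def by (simp add: q2 take_q succs2, rule work_mono) simp
    ultimately have "wp propagate (\<lambda>t' s'. closed_state Vs s' \<and> arcs s' = arcs s @ [(u, v)] \<and> extends s s' \<and>
        same_args s s' \<and> t2 + (1 + t') + 12 * potential s \<le> 12 * potential s' + 9 * length Vs + 3) ?s"
    proof (elim wp_mono conjE, intro conjI)
      fix t' s'
      assume wf': "wf_state Vs s'" and f': "frame {''len'', ''k''} ?s s'"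
        and t': "t' + 12 * work (succs ?s) (take (regs ?s ''q'') (wits ?s)) \<le> 12 * potential s' + 1"
        and closed': "\<forall>(r, x) \<in> pairs (wits s'). closed_at s' r x"
      assume pot: "potential s \<le> work (succs ?s) (take (regs ?s ''q'') (wits ?s))"
      show arcs': "arcs s' = arcs s @ [(u, v)]" using f' arcs2 by (simp add: frame_def)
      show "extends s s'" using f' M by (auto simp: frame_def extends_def)
      show "same_args s s'" using f' f2 args1 by (simp add: frame_def same_args_def)
      show "t2 + (1 + t') + 12 * potential s \<le> 12 * potential s' + 9 * length Vs + 3"
        using t' t2 pot by linarith
      have "pairs (wits s) \<subseteq> pairs (wits s')" "(u, v) \<in> pairs (wits s')"
        using f' M by (auto simp: frame_def in_pairs_iff)
      then have "set (arcs s') \<subseteq> pairs (wits s')"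
        using inv unfolding arcs' closed_state_def by auto
      then show "closed_state Vs s'" using wf' closed' by (simp add: closed_state_def)
    qed
    then show "wp (Seq (Assign ''j'' (Const 0)) propagate) (\<lambda>t' s'. closed_state Vs s' \<and>
        arcs s' = arcs s @ [(u, v)] \<and> extends s s' \<and> same_args s s' \<and>
        t2 + t' + 12 * potential s \<le> 12 * potential s' + 9 * length Vs + 3) s2"
      by simp
  qed
  then show ?thesis
    unfolding insert_arc_def s1_def q_def
    by (simp add: uv) (erule wp_mono, erule wp_mono, simp)
qed

text \<open>A redundant arc changes only \<open>arcs\<close> and leaves \<open>potential\<close> as
  it is. In the other case 7 steps, including the branch test, precede the 16 of
  \<open>wp_insert_arc\<close>.\<close>

lemma wp_add_arc:
  assumes inv: "closed_state Vs s" and k: "regs s ''k'' = k" and uv: "(mem s 0 k, mem s 1 k) = (u, v)"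
    and V: "u \<in> set Vs" "v \<in> set Vs" "u \<noteq> v" and new: "(u, v) \<notin> set (arcs s)"
  shows "wp add_arc (\<lambda>t s'. closed_state Vs s' \<and> arcs s' = arcs s @ [(u, v)] \<and> extends s s' \<and>
     mem s' 0 = mem s 0 \<and> mem s' 1 = mem s 1 \<and> regs s' ''len'' = regs s ''len'' \<and>
     regs s' ''k'' = Suc k \<and> t + 12 * potential s \<le> 12 * potential s' + 9 * length Vs + 23) s"
proof -
  let ?s = "set_reg ''k'' (Suc k) (set_reg ''v'' v (set_reg ''u'' u s))"
  have inv': "closed_state Vs ?s" using inv by simp
  then have wf: "wf_state Vs ?s" by (simp add: closed_state_def)
  have reach: "reach s u v = (if (u, v) \<in> pairs (wits s) then 1 else 0)"
    using wf_state_reach[OF wf V(1,2)] V(3) by simp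
  show ?thesis
  proof (cases "(u, v) \<in> pairs (wits s)")
    case True
    have "wf_state Vs (put_arc ?s)"
      using wf V new unfolding wf_state_def by simp blast
    then have "closed_state Vs (put_arc ?s)"
      using inv' True by (simp add: closed_state_def closed_at_def)
    moreover have "potential (put_arc ?s) = potential s" by (simp add: potential_def)
    ultimately show ?thesis using k uv True reach
      by (simp add: add_arc_def extends_def)
  next
    case False
    have "wp insert_arc (\<lambda>t s'. closed_state Vs s' \<and> arcs s' = arcs ?s @ [(u, v)] \<and> extends ?s s' \<and>
       same_args ?s s' \<and> t + 12 * potential ?s \<le> 12 * potential s' + 9 * length Vs + 16) (put_arc ?s)"
      using inv' V new False by (intro wp_insert_arc) auto
    then show ?thesis using k uv False reach
      by (simp add: add_arc_def) (erule wp_mono, simp add: same_args_def)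
  qed
qed

lemma pass_arcs_simps [simp]:
  "wits (pass_arcs F s) = wits s" "arcs (pass_arcs F s) = arcs s" "succs (pass_arcs F s) = succs s"
  "x \<noteq> ''len'' \<Longrightarrow> regs (pass_arcs F s) x = regs s x" "regs (pass_arcs F s) ''len'' = length F"
  "r > 1 \<Longrightarrow> mem (pass_arcs F s) r = mem s r"
  "i < length F \<Longrightarrow> mem (pass_arcs F s) 0 i = fst (F ! i)"
  "i < length F \<Longrightarrow> mem (pass_arcs F s) (Suc 0) i = snd (F ! i)"
  by (auto simp: pass_arcs_def put_array_def wits_def arcs_def succs_def fun_eq_iff set_reg_def)

lemma pass_nodes_simps [simp]:
  "wits (pass_nodes S s) = wits s" "arcs (pass_nodes S s) = arcs s" "succs (pass_nodes S s) = succs s"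
  "x \<noteq> ''len'' \<Longrightarrow> regs (pass_nodes S s) x = regs s x" "regs (pass_nodes S s) ''len'' = length S"
  "r > 0 \<Longrightarrow> mem (pass_nodes S s) r = mem s r"
  "i < length S \<Longrightarrow> mem (pass_nodes S s) 0 i = S ! i"
  by (auto simp: pass_nodes_def put_array_def wits_def arcs_def succs_def fun_eq_iff set_reg_def)

lemma closed_state_pass_arcs: "closed_state Vs s \<Longrightarrow> closed_state Vs (pass_arcs F s)"
  by (auto simp: closed_state_def wf_state_def closed_at_def)

lemma closed_state_pass_nodes: "closed_state Vs s \<Longrightarrow> closed_state Vs (pass_nodes S s)"
  by (auto simp: closed_state_def wf_state_def closed_at_def)

text \<open>The 24 is the 23 of \<open>wp_add_arc\<close> plus a loop test; the 2 is the initial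
  assignment and the final test.\<close>

lemma wp_add_prog:
  assumes inv: "closed_state Vs s" and F: "distinct F" "set F \<subseteq> set Vs \<times> set Vs"
    "set F \<inter> set (arcs s) = {}" "\<forall>(a, b) \<in> set F. a \<noteq> b"
  shows "wp add_prog (\<lambda>t s'. closed_state Vs s' \<and> arcs s' = arcs s @ F \<and> extends s s' \<and>
     t + 12 * potential s \<le> 12 * potential s' + length F * (9 * length Vs + 24) + 2) (pass_arcs F s)"
proof -
  let ?s = "set_reg ''k'' 0 (pass_arcs F s)"
  have "wp (While (Less (Reg ''k'') (Reg ''len'')) add_arc) (\<lambda>t s'. closed_state Vs s' \<and> arcs s' = arcs s @ F \<and>
     extends s s' \<and> t + 12 * potential s \<le> 12 * potential s' + length F * (9 * length Vs + 24) + 1) ?s"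
  proof (rule wp_While[where B = "length F" and I = "\<lambda>k t s'. closed_state Vs s' \<and> k \<le> length F \<and>
      regs s' ''k'' = k \<and> regs s' ''len'' = length F \<and> arcs s' = arcs s @ take k F \<and> extends s s' \<and>
      mem s' 0 = mem ?s 0 \<and> mem s' 1 = mem ?s 1 \<and>
      t + 12 * potential s \<le> 12 * potential s' + k * (9 * length Vs + 24)"], goal_cases)
    case 1
    then show ?case using inv by (simp add: closed_state_pass_arcs extends_def potential_def)
  next
    case (2 k t s')
    then show ?case by simp
  next
    case (3 k t s')
    then have k: "k < length F" by simp
    obtain u v where uv: "F ! k = (u, v)" by fastforce
    have mem: "(u, v) \<in> set F" using k uv nth_mem by metis
    have fresh: "(u, v) \<notin> set (take k F)"
      using F(1) k id_take_nth_drop[OF k] uv by (metis distinct_append disjoint_insert(1) list.simps(15))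
    have "wp add_arc (\<lambda>t s''. closed_state Vs s'' \<and> arcs s'' = arcs s' @ [(u, v)] \<and> extends s' s'' \<and>
       mem s'' 0 = mem s' 0 \<and> mem s'' 1 = mem s' 1 \<and> regs s'' ''len'' = regs s' ''len'' \<and>
       regs s'' ''k'' = Suc k \<and> t + 12 * potential s' \<le> 12 * potential s'' + 9 * length Vs + 23) s'"
      using 3 k uv F mem fresh by (intro wp_add_arc) auto
    then show ?case
    proof (rule wp_mono)
      fix t' s''
      assume *: "closed_state Vs s'' \<and> arcs s'' = arcs s' @ [(u, v)] \<and> extends s' s'' \<and>
       mem s'' 0 = mem s' 0 \<and> mem s'' 1 = mem s' 1 \<and> regs s'' ''len'' = regs s' ''len'' \<and>
       regs s'' ''k'' = Suc k \<and> t' + 12 * potential s' \<le> 12 * potential s'' + 9 * length Vs + 23"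
      have "extends s s''" using 3 * extends_trans by blast
      moreover have "arcs s'' = arcs s @ take (Suc k) F"
        using 3 * k uv by (simp add: take_Suc_conv_app_nth)
      moreover have "1 + t + t' + 12 * potential s \<le> 12 * potential s'' + Suc k * (9 * length Vs + 24)"
        using 3 * by simp
      ultimately show "closed_state Vs s'' \<and> Suc k \<le> length F \<and>
          regs s'' ''k'' = Suc k \<and> regs s'' ''len'' = length F \<and>
          arcs s'' = arcs s @ take (Suc k) F \<and> extends s s'' \<and>
          mem s'' 0 = mem ?s 0 \<and> mem s'' 1 = mem ?s 1 \<and>
          1 + t + t' + 12 * potential s \<le> 12 * potential s'' + Suc k * (9 * length Vs + 24)"
        using 3 * k by simp
    qed
  next
    case (4 k t s')
    then show ?case by auto
  qed
  then show ?thesis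
    unfolding add_prog_def by simp
qed

section \<open>Initialisation and covers\<close>

text \<open>Step \<open>k\<close> of a single loop over all pairs of indices below \<open>l\<close>,
  row by row. The pair \<open>(l, 0)\<close> is the end position, which for \<open>l = 0\<close> is
  also the start.\<close>

definition pair_pos :: "nat \<Rightarrow> nat \<Rightarrow> nat \<Rightarrow> nat \<Rightarrow> bool" where
  "pair_pos l k i j \<longleftrightarrow> k = i * l + j \<and> (i < l \<and> j < l \<or> i = l \<and> j = 0)"

lemma pair_pos_0: "pair_pos l 0 0 0"
  by (auto simp: pair_pos_def)

lemma pair_pos_le: "pair_pos l k i j \<Longrightarrow> k \<le> l * l"
proof -
  assume *: "pair_pos l k i j"
  have "i * l + j \<le> l * l" if "i < l" "j < l"
  proof -
    have "i * l + j \<le> Suc i * l" using that by simp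
    also have "\<dots> \<le> l * l" using that by (intro mult_le_mono1) simp
    finally show ?thesis .
  qed
  with * show ?thesis by (auto simp: pair_pos_def)
qed

lemma pair_pos_end: "pair_pos l k i j \<Longrightarrow> \<not> i < l \<Longrightarrow> k = l * l"
  by (auto simp: pair_pos_def)

lemma pair_index_less: "i < l \<Longrightarrow> j < l \<Longrightarrow> i * l + j < l * (l :: nat)"
  using mult_le_mono1[of "Suc i" l l] by simp

text \<open>Division by \<open>l\<close> recovers the row, so distinct index pairs have distinct
  positions and a round adds exactly one pair.\<close>

lemma pair_index_less_Suc:
  assumes "pair_pos l k i j" "i < l" "j' < l"
  shows "i' * l + j' < Suc k \<longleftrightarrow> i' * l + j' < k \<or> i' = i \<and> j' = j"
proof -
  have "i' * l + j' = i * l + j \<longleftrightarrow> i' = i \<and> j' = j"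
  proof
    assume eq: "i' * l + j' = i * l + j"
    have "j < l" using assms by (simp add: pair_pos_def)
    then have "(i' * l + j') div l = i'" "(i * l + j) div l = i" using assms by simp_all
    with eq show "i' = i \<and> j' = j" by simp
  qed simp
  with assms(1) show ?thesis by (auto simp: pair_pos_def less_Suc_eq)
qed

lemma wp_next_pair:
  assumes "pair_pos l k i j" "i < l" "regs s ''i'' = i" "regs s ''j'' = j" "regs s ''len'' = l"
    and "\<And>t i' j'. t \<le> 4 \<Longrightarrow> pair_pos l (Suc k) i' j' \<Longrightarrow>
      Q t (set_reg ''i'' i' (set_reg ''j'' j' s))"
  shows "wp next_pair Q s"
proof (cases "Suc j < l")
  case True
  then have "pair_pos l (Suc k) i (Suc j)" using assms(1,2) by (auto simp: pair_pos_def)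
  then have "Q 3 (set_reg ''i'' i (set_reg ''j'' (Suc j) s))" by (intro assms(6)) simp_all
  \<comment> \<open>Here \<open>i\<close> is not written; restoring its own value gives both
    branches the form required by \<open>Q\<close>.\<close>
  moreover have "set_reg ''i'' i (set_reg ''j'' (Suc j) s) = set_reg ''j'' (Suc j) s"
    using assms(3) by (simp add: set_reg_def fun_upd_idem)
  ultimately show ?thesis
    using True assms(4,5) by (simp add: next_pair_def eval_nat_numeral)
next
  case False
  then have "Suc j = l" using assms(1,2) by (auto simp: pair_pos_def)
  then have "pair_pos l (Suc k) (Suc i) 0" using assms(1,2) by (auto simp: pair_pos_def)
  then have "Q 4 (set_reg ''i'' (Suc i) (set_reg ''j'' 0 s))" by (intro assms(6)) simp_all
  moreover have "set_reg ''j'' 0 (set_reg ''i'' (Suc i) (set_reg ''j'' (Suc j) s)) =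
      set_reg ''i'' (Suc i) (set_reg ''j'' 0 s)"
    by (simp add: set_reg_def fun_upd_twist)
  ultimately show ?thesis
    using False assms(3,4,5) by (simp add: next_pair_def eval_nat_numeral)
qed

lemma closed_state_initial:
  assumes "regs s ''n'' = length Vs" "regs s ''m'' = 0" "regs s ''wl_len'' = 0"
    and "\<And>i. i < length Vs \<Longrightarrow> mem s 2 i = Vs ! i \<and> mem s 8 (Vs ! i) = 0"
    and "\<And>i j. i < length Vs \<Longrightarrow> j < length Vs \<Longrightarrow>
      reach s (Vs ! i) (Vs ! j) = (if Vs ! i = Vs ! j then 1 else 0)"
  shows "closed_state Vs s" "arcs s = []" "wits s = []"
proof -
  show e: "arcs s = []" "wits s = []" using assms by (auto simp: arcs_def wits_def)
  have "succs s x = []" if "x \<in> set Vs" for x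
    using that assms(4) by (auto simp: succs_def in_set_conv_nth)
  then show "closed_state Vs s"
    unfolding closed_state_def wf_state_def e
    using assms by (auto simp: in_set_conv_nth intro: arcwise.Nil)
qed

lemma wp_init_prog:
  "wp init_prog (\<lambda>t s'. closed_state Vs s' \<and> arcs s' = [] \<and> wits s' = [] \<and>
     t \<le> 10 * (length Vs)\<^sup>2 + 6) (pass_nodes Vs s)"
proof -
  let ?l = "length Vs"
  have loop: "wp init_loop
     (\<lambda>t s'. closed_state Vs s' \<and> arcs s' = [] \<and> wits s' = [] \<and> t \<le> 10 * (?l * ?l) + 1) s1"
    if s1: "regs s1 ''n'' = ?l" "regs s1 ''m'' = 0" "regs s1 ''wl_len'' = 0" "regs s1 ''len'' = ?l"
      "regs s1 ''i'' = 0" "regs s1 ''j'' = 0" "\<forall>i < ?l. mem s1 0 i = Vs ! i" for s1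
  unfolding init_loop_def
  proof (rule wp_While[where B = "?l * ?l" and I = "\<lambda>k t s'. t \<le> 10 * k \<and>
      pair_pos ?l k (regs s' ''i'') (regs s' ''j'') \<and> regs s' ''n'' = ?l \<and> regs s' ''m'' = 0 \<and>
      regs s' ''wl_len'' = 0 \<and> regs s' ''len'' = ?l \<and> (\<forall>i < ?l. mem s' 0 i = Vs ! i) \<and>
      (\<forall>i < ?l. \<forall>j < ?l. i * ?l + j < k \<longrightarrow> mem s' 2 i = Vs ! i \<and> mem s' 8 (Vs ! i) = 0 \<and>
         reach s' (Vs ! i) (Vs ! j) = (if Vs ! i = Vs ! j then 1 else 0))"], goal_cases)
    case 1
    then show ?case using s1 by (simp add: pair_pos_0)
  next
    case (2 k t s')
    then show ?case using pair_pos_le by blast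
  next
    case (3 k t s')
    let ?i = "regs s' ''i''"
    let ?j = "regs s' ''j''"
    have pos: "pair_pos ?l k ?i ?j" and i: "?i < ?l" and j: "?j < ?l"
      using 3 by (auto simp: pair_pos_def)
    note less = pair_index_less_Suc[OF pos i]
    show ?case by simp (rule wp_next_pair[OF pos i], use 3 i j less in auto)
  next
    case (4 k t s')
    then have k: "k = ?l * ?l" using pair_pos_end by auto
    have all: "mem s' 2 i = Vs ! i" "mem s' 8 (Vs ! i) = 0"
         "reach s' (Vs ! i) (Vs ! j) = (if Vs ! i = Vs ! j then 1 else 0)"
      if "i < ?l" "j < ?l" for i j
      using 4 that pair_index_less[OF that] unfolding k by blast+
    show ?case
      using 4 k closed_state_initial[of s' Vs] all by auto
  qed
  show ?thesis
    unfolding init_prog_def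
    by simp (rule wp_mono[OF loop], auto simp: power2_eq_square)
qed

section \<open>Covers\<close>

definition put_out :: "state \<Rightarrow> state" where
  "put_out s = set_reg ''arcs_len'' (Suc (regs s ''arcs_len''))
     (set_cell 10 (regs s ''arcs_len'') (regs s ''b'')
     (set_cell 9 (regs s ''arcs_len'') (regs s ''a'') s))"

definition out :: "state \<Rightarrow> arc list" where
  "out s = map (\<lambda>i. (mem s 9 i, mem s 10 i)) [0..<regs s ''arcs_len'']"

lemma put_out_simps [simp]:
  "regs (put_out s) z = (if z = ''arcs_len'' then Suc (regs s z) else regs s z)"
  "r < 9 \<Longrightarrow> mem (put_out s) r = mem s r"
  "reach (put_out s) x = reach s x"
  "wits (put_out s) = wits s"
  "arcs (put_out s) = arcs s"
  "succs (put_out s) = succs s"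
  "out (put_out s) = out s @ [(regs s ''a'', regs s ''b'')]"
  by (auto simp: put_out_def out_def fun_eq_iff)

lemma out_set_reg [simp]: "x \<noteq> ''arcs_len'' \<Longrightarrow> out (set_reg x v s) = out s"
  by (simp add: out_def)

lemma closed_state_put_out [simp]: "closed_state Vs (put_out s) = closed_state Vs s"
  by (simp add: closed_state_def wf_state_def closed_at_def)

lemma wp_push_out [simp]: "wp push_out Q s \<longleftrightarrow> Q 3 (put_out s)"
  by (simp add: push_out_def put_out_def eval_nat_numeral)

lemma zip_map_same: "zip (map f xs) (map g xs) = map (\<lambda>x. (f x, g x)) xs"
  by (induction xs) auto

lemma transitive_cover_all:
  assumes "S \<subseteq> V" "E \<subseteq> V \<times> V" "\<forall>(a, b) \<in> E. a \<noteq> b"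
  shows "transitive_cover V E S V E"
  using assms by (auto simp: transitive_cover_def tr_on_def tr_iff)

text \<open>The restricted closure reaches nothing new because it lies in \<open>E\<^sup>*\<close>,
  and it loses nothing because each of its pairs is itself an arc.\<close>

lemma transitive_cover_closure:
  assumes "S \<subseteq> V"
  shows "transitive_cover V E S S (tr_on E S)"
proof -
  have "(tr_on E S)\<^sup>* \<subseteq> E\<^sup>*"
    by (rule rtrancl_subset_rtrancl) (auto simp: tr_on_def tr_iff)
  then have "tr_on (tr_on E S) S \<subseteq> tr_on E S" by (auto simp: tr_on_def tr_iff)
  moreover have "tr_on E S \<subseteq> tr_on (tr_on E S) S"
    using tr_iff by (fastforce simp: tr_on_def intro: r_into_rtrancl)
  ultimately show ?thesis using assms by (auto simp: transitive_cover_def)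
qed

text \<open>Two clauses serve later calls: unchanged \<open>succs\<close> and \<open>wits\<close>
  keep \<open>potential\<close> fixed between additions, and the inclusion in
  \<open>pairs (wits s)\<close> gives every output arc an entry that \<open>TcWitList\<close> can
  show.\<close>

definition cover_post :: "node list \<Rightarrow> state \<Rightarrow> node list \<Rightarrow> nat \<Rightarrow> state \<Rightarrow> bool" where
  "cover_post Vs s S t s' \<longleftrightarrow> closed_state Vs s' \<and> arcs s' = arcs s \<and> wits s' = wits s \<and>
     succs s' = succs s \<and> distinct (cover_nodes s') \<and> distinct (cover_arcs s') \<and>
     transitive_cover (set Vs) (set (arcs s)) (set S) (set (cover_nodes s')) (set (cover_arcs s')) \<and>
     set (cover_arcs s') \<subseteq> pairs (wits s) \<and>
     t \<le> 11 * min ((length S)\<^sup>2) (length (arcs s)) + 9 \<and>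
     card (set (cover_arcs s')) \<le> min ((length S)\<^sup>2) (length (arcs s))"

definition listed :: "node list \<Rightarrow> arc set \<Rightarrow> nat \<Rightarrow> arc set" where
  "listed S P k = {(S ! i, S ! j) | i j. i < length S \<and> j < length S \<and> i * length S + j < k} \<inter> P"

lemma listed_0 [simp]: "listed S P 0 = {}"
  by (simp add: listed_def)

lemma listed_Suc:
  assumes "pair_pos (length S) k i j" "i < length S"
  shows "listed S P (Suc k) = listed S P k \<union> {(S ! i, S ! j)} \<inter> P"
proof -
  have "j < length S" using assms by (simp add: pair_pos_def)
  moreover have "{(S ! i', S ! j') | i' j'. i' < length S \<and> j' < length S \<and> i' * length S + j' < Suc k} =
    {(S ! i', S ! j') | i' j'. i' < length S \<and> j' < length S \<and>
       (i' * length S + j' < k \<or> i' = i \<and> j' = j)}"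
    using pair_index_less_Suc[OF assms] by blast
  ultimately show ?thesis using assms(2) unfolding listed_def by blast
qed

text \<open>As \<open>S\<close> is distinct, different index pairs name different node pairs; this
  keeps the output free of repetitions.\<close>

lemma listed_fresh:
  assumes "pair_pos (length S) k i j" "i < length S" "distinct S"
  shows "(S ! i, S ! j) \<notin> listed S P k"
  using assms by (auto simp: listed_def pair_pos_def nth_eq_iff_index_eq)

lemma listed_end: "listed S P (length S * length S) = set S \<times> set S \<inter> P"
  unfolding listed_def using pair_index_less by (auto simp: in_set_conv_nth) blast

lemma wp_cover_pairs:
  assumes s: "closed_state Vs s" and S: "distinct S" "set S \<subseteq> set Vs"
  shows "wp cover_pairs (\<lambda>t s'. closed_state Vs s' \<and> arcs s' = arcs s \<and> wits s' = wits s \<and>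
     succs s' = succs s \<and> cover_nodes s' = S \<and> distinct (cover_arcs s') \<and>
     set (cover_arcs s') = tr_on (set (arcs s)) (set S) \<and> t \<le> 11 * (length S)\<^sup>2 + 8)
     (pass_nodes S s)"
proof -
  let ?l = "length S"
  have loop: "wp cover_loop
     (\<lambda>t s'. closed_state Vs s' \<and> arcs s' = arcs s \<and> wits s' = wits s \<and>
     succs s' = succs s \<and> cover_nodes s' = S \<and> distinct (cover_arcs s') \<and>
     set (cover_arcs s') = tr_on (set (arcs s)) (set S) \<and> t \<le> 11 * (?l * ?l) + 1) s1"
    if s1: "closed_state Vs s1" "arcs s1 = arcs s" "wits s1 = wits s" "succs s1 = succs s"
      "regs s1 ''len'' = ?l" "regs s1 ''i'' = 0" "regs s1 ''j'' = 0" "\<forall>i < ?l. mem s1 0 i = S ! i"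
      "regs s1 ''nodes'' = 0" "regs s1 ''nodes_len'' = ?l" "regs s1 ''tails'' = 9"
      "regs s1 ''heads'' = 10" "regs s1 ''arcs_len'' = 0" for s1
  unfolding cover_loop_def
  proof (rule wp_While[where B = "?l * ?l" and I = "\<lambda>k t s'. t \<le> 11 * k \<and>
      pair_pos ?l k (regs s' ''i'') (regs s' ''j'') \<and> closed_state Vs s' \<and> arcs s' = arcs s \<and>
      wits s' = wits s \<and> succs s' = succs s \<and> regs s' ''len'' = ?l \<and> (\<forall>i < ?l. mem s' 0 i = S ! i) \<and>
      regs s' ''nodes'' = 0 \<and> regs s' ''nodes_len'' = ?l \<and> regs s' ''tails'' = 9 \<and>
      regs s' ''heads'' = 10 \<and> distinct (out s') \<and>
      set (out s') = listed S (pairs (wits s)) k"], goal_cases)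
    case 1
    then show ?case using s1 by (simp add: pair_pos_0 out_def)
  next
    case (2 k t s')
    then show ?case using pair_pos_le by blast
  next
    case (3 k t s')
    let ?i = "regs s' ''i''"
    let ?j = "regs s' ''j''"
    have pos: "pair_pos ?l k ?i ?j" and i: "?i < ?l" and j: "?j < ?l"
      using 3 by (auto simp: pair_pos_def)
    have wf: "wf_state Vs s'" and L: "arcwise (set Vs) (wits s)"
      using 3 by (auto simp: closed_state_def wf_state_def)
    have V: "S ! ?i \<in> set Vs" "S ! ?j \<in> set Vs" using S i j by auto
    note reach = wf_state_reach[OF wf V]
    have arg: "mem s' 0 ?i = S ! ?i" "mem s' 0 ?j = S ! ?j" using 3 i j by auto
    note new = listed_Suc[OF pos i, of "pairs (wits s)"] listed_fresh[OF pos i S(1), of "pairs (wits s)"]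
    show ?case
    proof (cases "(S ! ?i, S ! ?j) \<in> pairs (wits s)")
      case True
      then have c: "reach s' (S ! ?i) (S ! ?j) = Suc 0" "S ! ?i \<noteq> S ! ?j"
        using reach arcwise_pairs(3)[OF L] 3 by auto
      show ?thesis
        by (simp add: arg c) (rule wp_next_pair[OF pos i], use 3 new True in simp_all)
    next
      case False
      then have "S ! ?i = S ! ?j \<or> reach s' (S ! ?i) (S ! ?j) = 0" using reach 3 by auto
      then show ?thesis
      proof
        assume "S ! ?i = S ! ?j"
        then show ?thesis
          by (simp add: arg) (rule wp_next_pair[OF pos i], use 3 new False in simp_all)
      next
        assume "reach s' (S ! ?i) (S ! ?j) = 0"
        then show ?thesis
          by (simp add: arg) (rule wp_next_pair[OF pos i], use 3 new False in simp_all)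
      qed
    qed
  next
    case (4 k t s')
    then have k: "k = ?l * ?l" using pair_pos_end by auto
    have "out s' = cover_arcs s'"
      using 4 by (simp add: out_def cover_arcs_def get_array_def zip_map_same)
    moreover have "set (out s') = tr_on (set (arcs s)) (set S)"
      using 4 closed_state_pairs[OF s] listed_end unfolding k
      by (simp add: tr_on_def Int_commute)
    moreover have "cover_nodes s' = S"
      using 4 by (intro nth_equalityI) (simp_all add: cover_nodes_def get_array_def)
    ultimately show ?case using 4 k by auto
  qed
  show ?thesis
    unfolding cover_pairs_def
    by simp (rule wp_mono[OF loop], auto simp: power2_eq_square s closed_state_pass_nodes)
qed

text \<open>The branch test picks the smaller of \<open>|S|^2\<close> and the number of arcs.
  Returning the stored graph takes 6 steps whatever its size, since only references and lengths are
  set.\<close>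

lemma wp_cover_prog:
  assumes Vs: "distinct Vs" and s: "closed_state Vs s" and S: "distinct S" "set S \<subseteq> set Vs"
  shows "wp cover_prog (cover_post Vs s S) (pass_nodes S s)"
proof (cases "length (arcs s) < length S * length S")
  case True
  let ?s = "set_reg ''arcs_len'' (regs s ''m'') (set_reg ''heads'' 7 (set_reg ''tails'' 6
    (set_reg ''nodes_len'' (regs s ''n'') (set_reg ''nodes'' 2 (pass_nodes S s)))))"
  have wf: "wf_state Vs s" using s by (simp add: closed_state_def)
  have arcs: "cover_arcs ?s = arcs s"
    by (simp add: cover_arcs_def get_array_def zip_map_same arcs_def)
  have nodes: "cover_nodes ?s = Vs"
    using wf by (intro nth_equalityI) (simp_all add: cover_nodes_def get_array_def wf_state_def)
  have "transitive_cover (set Vs) (set (arcs s)) (set S) (set Vs) (set (arcs s))"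
    using wf S by (intro transitive_cover_all) (auto simp: wf_state_def)
  moreover have "set (arcs s) \<subseteq> pairs (wits s)" "distinct (arcs s)"
    using s by (auto simp: closed_state_def wf_state_def)
  moreover have "min ((length S)\<^sup>2) (length (arcs s)) = length (arcs s)"
    using True by (simp add: power2_eq_square)
  ultimately have "cover_post Vs s S 6 ?s"
    unfolding cover_post_def arcs nodes
    using Vs s by (simp add: closed_state_pass_nodes distinct_card)
  then show ?thesis
    using True by (simp add: cover_prog_def cover_all_def eval_nat_numeral)
next
  case False
  then have min: "min ((length S)\<^sup>2) (length (arcs s)) = (length S)\<^sup>2"
    by (simp add: power2_eq_square)
  have "wp cover_pairs (\<lambda>t. cover_post Vs s S (1 + t)) (pass_nodes S s)"
  proof (rule wp_mono[OF wp_cover_pairs[OF s S]], elim conjE)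
    fix t s'
    assume s': "closed_state Vs s'" "arcs s' = arcs s" "wits s' = wits s" "succs s' = succs s"
      "cover_nodes s' = S" "distinct (cover_arcs s')" "t \<le> 11 * (length S)\<^sup>2 + 8"
      and F: "set (cover_arcs s') = tr_on (set (arcs s)) (set S)"
    have "card (tr_on (set (arcs s)) (set S)) \<le> card (set S \<times> set S)"
      by (intro card_mono) (auto simp: tr_on_def)
    also have "\<dots> = (length S)\<^sup>2"
      using S(1) by (simp add: card_cartesian_product distinct_card power2_eq_square)
    finally show "cover_post Vs s S (1 + t) s'"
      unfolding cover_post_def min F
      using s' S closed_state_pairs[OF s] transitive_cover_closure[OF S(2)] by (auto simp: tr_on_def)
  qed
  then show ?thesis using False by (simp add: cover_prog_def)
qed

section \<open>Sessions\<close>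

fun added :: "tc_op \<Rightarrow> arc list" where
  "added (TcAdd F) = F"
| "added x = []"

fun allowed :: "node set \<Rightarrow> arc set \<Rightarrow> tc_op \<Rightarrow> bool" where
  "allowed V E (TcAdd F) \<longleftrightarrow> distinct F \<and> set F \<subseteq> V \<times> V \<and> set F \<inter> E = {} \<and> (\<forall>(a, b) \<in> set F. a \<noteq> b)"
| "allowed V E (TcCover S) \<longleftrightarrow> distinct S \<and> set S \<subseteq> V"
| "allowed V E TcWitList \<longleftrightarrow> True"

text \<open>Additions satisfy an amortised bound, to be summed over the run; the other operations
  have worst-case bounds and preserve \<open>potential\<close>.\<close>

fun op_spec :: "node list \<Rightarrow> state \<Rightarrow> tc_op \<Rightarrow> nat \<Rightarrow> state \<Rightarrow> bool" where
  "op_spec Vs s (TcAdd F) t s' \<longleftrightarrow>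
     t + 12 * potential s \<le> 12 * potential s' + length F * (9 * length Vs + 24) + 2"
| "op_spec Vs s (TcCover S) t s' \<longleftrightarrow> cover_post Vs s S t s'"
| "op_spec Vs s TcWitList t s' \<longleftrightarrow> potential s' = potential s \<and> result_wl s' = wits s' \<and> t = 3"

lemma wp_op:
  assumes "distinct Vs" "closed_state Vs s" "allowed (set Vs) (set (arcs s)) x"
  shows "wp (op_code bfs_itco x) (\<lambda>t s'. closed_state Vs s' \<and> arcs s' = arcs s @ added x \<and>
     extends s s' \<and> op_spec Vs s x t s') (pass_args x s)"
proof (cases x)
  case (TcAdd F)
  then show ?thesis using wp_add_prog[of Vs s F] assms by (simp add: bfs_itco_def)
next
  case (TcCover S)
  have "wp cover_prog (cover_post Vs s S) (pass_nodes S s)"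
    using TcCover assms by (intro wp_cover_prog) auto
  then have "wp cover_prog (\<lambda>t s'. closed_state Vs s' \<and> arcs s' = arcs s \<and> extends s s' \<and>
      cover_post Vs s S t s') (pass_nodes S s)"
    by (rule wp_mono) (auto simp: cover_post_def extends_def)
  then show ?thesis using TcCover by (simp add: bfs_itco_def)
next
  case TcWitList
  then show ?thesis using assms
    by (simp add: bfs_itco_def witlist_prog_def result_wl_def get_array_def zip_map_same wits_def)
qed

lemma arcs_before_0 [simp]: "arcs_before xs 0 = {}"
  by (simp add: arcs_before_def)

lemma arcs_before_Suc:
  assumes "k < length xs"
  shows "arcs_before xs (Suc k) = arcs_before xs k \<union> set (added (xs ! k))"
  using assms by (cases "xs ! k") (auto simp: arcs_before_def take_Suc_conv_app_nth)

lemma admissible_iff: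
  "admissible V xs \<longleftrightarrow> (\<forall>k < length xs. allowed V (arcs_before xs k) (xs ! k))"
proof -
  have "allowed V E x \<longleftrightarrow> (\<forall>F. x = TcAdd F \<longrightarrow> distinct F \<and> set F \<subseteq> V \<times> V \<and>
      set F \<inter> E = {} \<and> (\<forall>(a, b) \<in> set F. a \<noteq> b)) \<and>
      (\<forall>S. x = TcCover S \<longrightarrow> distinct S \<and> set S \<subseteq> V)" for E x
    by (cases x) auto
  then show ?thesis unfolding admissible_def by simp
qed

lemma arcs_before_append: "k \<le> length xs \<Longrightarrow> arcs_before (xs @ ys) k = arcs_before xs k"
  by (simp add: arcs_before_def)

lemma admissible_snoc:
  "admissible V (xs @ [x]) \<longleftrightarrow> admissible V xs \<and> allowed V (arcs_before xs (length xs)) x"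
  unfolding admissible_iff by (auto simp: less_Suc_eq nth_append arcs_before_append)

lemma run_ops_nth:
  assumes "run_ops D s xs h"
  shows "length h = length xs"
    and "k < length xs \<Longrightarrow> exec (op_code D (xs ! k)) (pass_args (xs ! k) ((s # map snd h) ! k))
      (fst (h ! k)) ((s # map snd h) ! Suc k)"
proof -
  have "length h = length xs \<and> (\<forall>k < length xs. exec (op_code D (xs ! k))
      (pass_args (xs ! k) ((s # map snd h) ! k)) (fst (h ! k)) ((s # map snd h) ! Suc k))"
    using assms
  proof (induction rule: run_ops.induct)
    case (Cons x s t s' xs h)
    then show ?case by (auto simp: less_Suc_eq_0_disj)
  qed simp
  then show "length h = length xs"
    and "k < length xs \<Longrightarrow> exec (op_code D (xs ! k)) (pass_args (xs ! k) ((s # map snd h) ! k))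
      (fst (h ! k)) ((s # map snd h) ! Suc k)"
    by blast+
qed

lemma run_ops_snoc:
  assumes "run_ops D s xs h" "exec (op_code D x) (pass_args x ((s # map snd h) ! length xs)) t s'"
  shows "run_ops D s (xs @ [x]) (h @ [(t, s')])"
  using assms
proof (induction rule: run_ops.induct)
  case (Nil s)
  then show ?case by (auto intro: run_ops.intros)
next
  case (Cons y s u s1 xs h)
  then show ?case by (auto intro: run_ops.Cons)
qed

section \<open>Runs of the data structure\<close>

locale bfs_run =
  fixes Vs :: "node list" and s :: state and xs :: "tc_op list" and h :: "(nat \<times> state) list"
  assumes Vs: "distinct Vs" and adm: "admissible (set Vs) xs" and run: "run_ops bfs_itco s xs h"
    and start: "closed_state Vs s" "arcs s = []"
begin

text \<open>The state before operation \<open>k\<close> and its argument passing. The entries of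
  \<open>h\<close> hold end states, hence the shift by one.\<close>

abbreviation st :: "nat \<Rightarrow> state" where
  "st k \<equiv> (s # map snd h) ! k"

lemma state_after: "k < length xs \<Longrightarrow> snd (h ! k) = st (Suc k)"
  using run_ops_nth(1)[OF run] by simp

lemma step:
  assumes "k < length xs" "closed_state Vs (st k)" "set (arcs (st k)) = arcs_before xs k"
  shows "closed_state Vs (st (Suc k)) \<and> arcs (st (Suc k)) = arcs (st k) @ added (xs ! k) \<and>
     extends (st k) (st (Suc k)) \<and> op_spec Vs (st k) (xs ! k) (fst (h ! k)) (st (Suc k))"
proof (rule wp_exec[OF wp_op[OF Vs assms(2)] run_ops_nth(2)[OF run assms(1)]])
  show "allowed (set Vs) (set (arcs (st k))) (xs ! k)"
    using adm assms(1,3) by (simp add: admissible_iff)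
qed

lemma closed_state_st:
  assumes "k \<le> length xs"
  shows "closed_state Vs (st k) \<and> set (arcs (st k)) = arcs_before xs k"
  using assms
proof (induction k)
  case (Suc k)
  then show ?case using step[of k] by (simp add: arcs_before_Suc del: nth_Cons_Suc)
qed (use start in simp)

lemmas st_closed = closed_state_st[THEN conjunct1]
lemmas st_arcs = closed_state_st[THEN conjunct2]

lemma st_step:
  assumes "k < length xs"
  shows "arcs (st (Suc k)) = arcs (st k) @ added (xs ! k)" "extends (st k) (st (Suc k))"
    "op_spec Vs (st k) (xs ! k) (fst (h ! k)) (st (Suc k))"
  using step[OF assms] closed_state_st[of k] assms by (auto simp del: nth_Cons_Suc)

lemma card_arcs_before: "k \<le> length xs \<Longrightarrow> card (arcs_before xs k) = length (arcs (st k))"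
  using st_closed[of k] by (simp add: closed_state_def wf_state_def distinct_card flip: st_arcs)

lemma extends_st: "j \<le> k \<Longrightarrow> k \<le> length xs \<Longrightarrow> extends (st j) (st k)"
proof (induction k rule: dec_induct)
  case (step k)
  then show ?case using st_step(2)[of k] extends_trans by (simp del: nth_Cons_Suc)
qed simp

lemma correct_cover:
  assumes "k < length xs" "xs ! k = TcCover S"
  shows "correct_cover (set Vs) xs h k S"
  using st_step(3)[OF assms(1)] assms(2) st_arcs[of k] assms(1)
  unfolding correct_cover_def Let_def state_after[OF assms(1)]
  by (simp add: cover_post_def del: nth_Cons_Suc)

text \<open>The list grows only at its end. An arc output at time \<open>j\<close> was a pair of the
  list at that time, so its entry keeps its position, and all entries up to it use arcs that were
  present at time \<open>j\<close>.\<close>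

lemma correct_witlist:
  assumes k: "k < length xs" "xs ! k = TcWitList"
  shows "correct_witlist (set Vs) xs h k"
proof -
  let ?L = "wits (st (Suc k))"
  have L: "result_wl (snd (h ! k)) = ?L"
    using st_step(3)[OF k(1)] k(2) unfolding state_after[OF k(1)] by simp
  have wf: "wf_state Vs (st i)" if "i \<le> length xs" for i
    using st_closed[OF that] by (simp add: closed_state_def)
  have aw: "arcwise (set Vs) ?L" and arcs: "wl_arcs ?L \<subseteq> set (arcs (st (Suc k)))"
    using wf[of "Suc k"] k(1) unfolding wf_state_def by auto
  have "arcs_before xs (Suc k) = arcs_before xs k"
    using k by (simp add: arcs_before_Suc)
  then have sub: "wl_arcs ?L \<subseteq> arcs_before xs k"
    using arcs st_arcs[of "Suc k"] k(1) by simp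
  have "\<exists>i < length ?L. (a, b) = wpair (?L ! i) \<and> wl_arcs_upto ?L i \<subseteq> arcs_before xs j"
    if j: "j < k" "xs ! j = TcCover S" and ab: "(a, b) \<in> set (cover_arcs (snd (h ! j)))" for j S a b
  proof -
    have jl: "j < length xs" using j k by simp
    have "cover_post Vs (st j) S (fst (h ! j)) (st (Suc j))"
      using st_step(3)[OF jl] j(2) by simp
    then have "(a, b) \<in> pairs (wits (st j))"
      using ab unfolding state_after[OF jl] cover_post_def by blast
    then obtain i where i: "i < length (wits (st j))" "(a, b) = wpair (wits (st j) ! i)"
      unfolding pairs_def by (metis imageE in_set_conv_nth)
    obtain M where M: "?L = wits (st j) @ M"
      using extends_st[of j "Suc k"] j k unfolding extends_def by auto
    have "wl_arcs_upto ?L i \<subseteq> wl_arcs (wits (st j))"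
      using i(1) set_take_subset[of "Suc i" "wits (st j)"]
      unfolding M wl_arcs_upto_def wl_arcs_def by auto
    also have "\<dots> \<subseteq> arcs_before xs j"
      using wf[of j] st_arcs[of j] jl unfolding wf_state_def by auto
    finally show ?thesis
      using i unfolding M by (intro exI[of _ i]) (simp add: nth_append)
  qed
  then show ?thesis
    unfolding correct_witlist_def Let_def L
    using arcwise_witness_list[OF aw] arcwise_path_structured[OF aw] sub by blast
qed

lemma cover_bounds:
  assumes "k < length xs" "xs ! k = TcCover S"
  shows "fst (h ! k) \<le> 11 * min ((card (set S))\<^sup>2) (card (arcs_before xs k)) + 9"
    and "card (set (cover_arcs (snd (h ! k)))) \<le> min ((card (set S))\<^sup>2) (card (arcs_before xs k))"
proof -
  have "distinct S" using adm assms unfolding admissible_def by blast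
  then have "card (set S) = length S" by (rule distinct_card)
  moreover have "cover_post Vs (st k) S (fst (h ! k)) (st (Suc k))"
    using st_step(3)[OF assms(1)] assms(2) by simp
  ultimately show "fst (h ! k) \<le> 11 * min ((card (set S))\<^sup>2) (card (arcs_before xs k)) + 9"
    and "card (set (cover_arcs (snd (h ! k)))) \<le> min ((card (set S))\<^sup>2) (card (arcs_before xs k))"
    using card_arcs_before[of k] assms(1) unfolding state_after[OF assms(1)] cover_post_def by simp_all
qed

lemma witlist_bounds:
  assumes "k < length xs" "xs ! k = TcWitList"
  shows "fst (h ! k) = 3" and "length (result_wl (snd (h ! k))) \<le> (card (set Vs))\<^sup>2"
proof -
  have *: "fst (h ! k) = 3" "result_wl (snd (h ! k)) = wits (st (Suc k))"
    using st_step(3)[OF assms(1)] assms(2) unfolding state_after[OF assms(1)] by simp_all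
  then show "fst (h ! k) = 3" by simp
  have "arcwise (set Vs) (wits (st (Suc k)))"
    using st_closed[of "Suc k"] assms(1) unfolding closed_state_def wf_state_def by simp
  then show "length (result_wl (snd (h ! k))) \<le> (card (set Vs))\<^sup>2"
    unfolding * by (rule arcwise_length) simp
qed

text \<open>The amortised bounds are summed along the run; operations other than
  \<open>TcAdd\<close> contribute nothing and leave \<open>potential\<close> unchanged.\<close>

lemma add_time_prefix:
  assumes "j \<le> length xs"
  shows "(\<Sum>k \<in> {k. k < j \<and> (\<exists>F. xs ! k = TcAdd F)}. fst (h ! k)) + 12 * potential s \<le>
    12 * potential (st j) + card (arcs_before xs j) * (9 * length Vs + 26) +
    2 * length (filter (\<lambda>x. x = TcAdd []) (take j xs))"
  using assms
proof (induction j)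
  case (Suc j)
  let ?K = "\<lambda>j. {k. k < j \<and> (\<exists>F. xs ! k = TcAdd F)}"
  have j: "j < length xs" using Suc.prems by simp
  have card: "card (arcs_before xs (Suc j)) = card (arcs_before xs j) + length (added (xs ! j))"
    using card_arcs_before[of j] card_arcs_before[of "Suc j"] st_step(1)[OF j] j
    by (metis Suc_leI length_append less_imp_le_nat)
  show ?case
  proof (cases "\<exists>F. xs ! j = TcAdd F")
    case True
    then obtain F where F: "xs ! j = TcAdd F" by blast
    then have "?K (Suc j) = insert j (?K j)" by (auto simp: less_Suc_eq)
    then have "(\<Sum>k \<in> ?K (Suc j). fst (h ! k)) = fst (h ! j) + (\<Sum>k \<in> ?K j. fst (h ! k))" by simp
    moreover have "fst (h ! j) + 12 * potential (st j) \<le>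
        12 * potential (st (Suc j)) + length F * (9 * length Vs + 24) + 2"
      using st_step(3)[OF j] F by simp
    \<comment> \<open>The 2 steps of overhead are charged to the arcs of the call, which raises 24
      to 26, or to \<open>empty_adds\<close> if there are none.\<close>
    moreover have "length F * (9 * length Vs + 24) + 2 \<le>
        length F * (9 * length Vs + 26) + 2 * length (filter (\<lambda>x. x = TcAdd []) [xs ! j])"
      using F by (cases F) (auto simp: algebra_simps)
    ultimately show ?thesis
      using Suc j F unfolding card by (simp add: take_Suc_conv_app_nth algebra_simps del: nth_Cons_Suc)
  next
    case False
    then have "?K (Suc j) = ?K j" by (auto simp: less_Suc_eq)
    moreover have "potential (st (Suc j)) = potential (st j)" "added (xs ! j) = []"
      using st_step(3)[OF j] False
      by (cases "xs ! j"; auto simp: cover_post_def potential_def simp del: nth_Cons_Suc)+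
    ultimately show ?thesis
      using Suc j unfolding card by (simp add: take_Suc_conv_app_nth del: nth_Cons_Suc)
  qed
qed simp

lemma add_time:
  assumes "n = card (set Vs)" "m = card (arcs_final xs)"
  shows "(\<Sum>k \<in> {k. k < length xs \<and> (\<exists>F. xs ! k = TcAdd F)}. fst (h ! k)) \<le>
    12 * (n * n) + 47 * (m * n) + 2 * empty_adds xs"
proof -
  have n: "n = length Vs" using assms(1) Vs by (simp add: distinct_card)
  have arcs: "set (arcs (st (length xs))) = arcs_final xs"
    using st_arcs[of "length xs"] by (simp add: arcs_final_def)
  have wf: "wf_state Vs (st (length xs))" using st_closed[of "length xs"] by (simp add: closed_state_def)
  have "potential (st (length xs)) \<le> n * (n + m)"
    using wf_state_potential[OF wf] unfolding arcs assms .
  \<comment> \<open>Absorbs the terms linear in \<open>m\<close>; the coefficient of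
    \<open>m * n\<close> becomes 12 + 9 + 26 = 47.\<close>
  moreover have "m \<le> m * n"
  proof (cases n)
    case 0
    then have "arcs_final xs = {}" using wf n unfolding arcs[symmetric] wf_state_def by simp
    then show ?thesis using assms(2) by simp
  qed simp
  moreover have "(\<Sum>k \<in> {k. k < length xs \<and> (\<exists>F. xs ! k = TcAdd F)}. fst (h ! k)) \<le>
      12 * potential (st (length xs)) + m * (9 * n + 26) + 2 * empty_adds xs"
    using add_time_prefix[of "length xs"] assms(2) n by (simp add: arcs_final_def empty_adds_def)
  moreover have "n * (n + m) = n * n + m * n" "m * (9 * n + 26) = 9 * (m * n) + 26 * m"
    by (simp_all add: algebra_simps)
  ultimately show ?thesis by linarith
qed

end

text \<open>Reverse induction, because the next operation terminates only from a state that
  satisfies the invariant, and this is known from the run of the prefix.\<close>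

lemma run_ops_exists:
  assumes "distinct Vs" "closed_state Vs s" "arcs s = []" "admissible (set Vs) xs"
  shows "\<exists>h. run_ops bfs_itco s xs h"
  using assms(4)
proof (induction xs rule: rev_induct)
  case Nil
  then show ?case using run_ops.Nil by blast
next
  case (snoc x xs)
  then obtain h where h: "run_ops bfs_itco s xs h" by (auto simp: admissible_snoc)
  interpret bfs_run Vs s xs h
    using assms h snoc.prems by unfold_locales (auto simp: admissible_snoc)
  have "allowed (set Vs) (set (arcs (st (length xs)))) x"
    using snoc.prems st_arcs[of "length xs"] by (simp add: admissible_snoc)
  from wp_op[OF assms(1) st_closed[OF order_refl] this] obtain t s' where
    "exec (op_code bfs_itco x) (pass_args x (st (length xs))) t s'"
    by (auto simp: wp_def)
  then show ?case using run_ops_snoc[OF h] by blast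
qed

lemma session_bfs_run:
  assumes "distinct Vs" "admissible (set Vs) xs" "session bfs_itco Vs xs t\<^sub>0 h"
  obtains s where "bfs_run Vs s xs h" "t\<^sub>0 \<le> 10 * (length Vs)\<^sup>2 + 6"
proof -
  obtain s s\<^sub>0 where "exec init_prog (pass_nodes Vs s) t\<^sub>0 s\<^sub>0" and run: "run_ops bfs_itco s\<^sub>0 xs h"
    using assms(3) unfolding session_def session_from_def bfs_itco_def by auto
  from wp_exec[OF wp_init_prog this(1)] have
    "closed_state Vs s\<^sub>0" "arcs s\<^sub>0 = []" "t\<^sub>0 \<le> 10 * (length Vs)\<^sup>2 + 6" by simp_all
  with that[of s\<^sub>0] assms run show thesis by (simp add: bfs_run_def)
qed

lemma is_ITCO_bfs_itco: "is_ITCO bfs_itco"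
  unfolding is_ITCO_def
proof (intro allI impI conjI)
  fix Vs xs s
  assume *: "distinct Vs \<and> admissible (set Vs) xs"
  obtain t s\<^sub>0 where "exec init_prog (pass_nodes Vs s) t s\<^sub>0" "closed_state Vs s\<^sub>0" "arcs s\<^sub>0 = []"
    using wp_init_prog[of Vs s] unfolding wp_def by blast
  moreover from this run_ops_exists[of Vs s\<^sub>0 xs] * obtain h where "run_ops bfs_itco s\<^sub>0 xs h" by blast
  ultimately show "\<exists>t\<^sub>0 h. session_from s bfs_itco Vs xs t\<^sub>0 h"
    unfolding session_from_def by (auto simp: bfs_itco_def)
next
  fix Vs xs t\<^sub>0 h k S
  assume *: "distinct Vs \<and> admissible (set Vs) xs" "session bfs_itco Vs xs t\<^sub>0 h" "k < length xs"
    "xs ! k = TcCover S"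
  then obtain s where "bfs_run Vs s xs h" using session_bfs_run by blast
  then show "correct_cover (set Vs) xs h k S" using * by (intro bfs_run.correct_cover)
next
  fix Vs xs t\<^sub>0 h k
  assume *: "distinct Vs \<and> admissible (set Vs) xs" "session bfs_itco Vs xs t\<^sub>0 h" "k < length xs"
    "xs ! k = TcWitList"
  then obtain s where "bfs_run Vs s xs h" using session_bfs_run by blast
  then show "correct_witlist (set Vs) xs h k" using * by (intro bfs_run.correct_witlist)
qed

theorem theorem7p3:
  shows "\<exists>(D :: itco) (C :: nat). is_ITCO D \<and>
    (\<forall>(n :: nat) (Vs :: node list) (xs :: tc_op list) (t\<^sub>0 :: nat) (h :: (nat \<times> state) list).
       distinct Vs \<and> n = card (set Vs) \<and> admissible (set Vs) xs \<and> session D Vs xs t\<^sub>0 h \<longrightarrow>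
         update_time xs t\<^sub>0 h \<le> C * (1 + (n + card (arcs_final xs)) * n + empty_adds xs) \<and>
         (\<forall>k < length xs. \<forall>S. xs ! k = TcCover S \<longrightarrow>
            fst (h ! k) \<le> C * (1 + min ((card (set S))\<^sup>2) (card (arcs_before xs k))) \<and>
            card (set (cover_arcs (snd (h ! k))))
              \<le> C * min ((card (set S))\<^sup>2) (card (arcs_before xs k))) \<and>
         (\<forall>k < length xs. xs ! k = TcWitList \<longrightarrow>
            length (result_wl (snd (h ! k))) \<le> C * n\<^sup>2 \<and>
            fst (h ! k) \<le> C * (1 + n\<^sup>2)))"
\<comment> \<open>The coefficient 47 of \<open>m * n\<close> in \<open>add_time\<close> is the
  largest: initialisation and additions together need 22 for \<open>n * n\<close>, and a cover needs
  11 and 9.\<close>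
proof (intro exI[of _ bfs_itco] exI[of _ 47] conjI is_ITCO_bfs_itco allI impI; elim conjE)
  fix n Vs xs t\<^sub>0 h
  assume n: "n = card (set Vs)" and Vs: "distinct Vs" and "admissible (set Vs) xs"
    "session bfs_itco Vs xs t\<^sub>0 h"
  then obtain s where run: "bfs_run Vs s xs h" and t: "t\<^sub>0 \<le> 10 * (length Vs)\<^sup>2 + 6"
    using session_bfs_run by blast
  have "length Vs = n" using n Vs by (simp add: distinct_card)
  then show "update_time xs t\<^sub>0 h \<le> 47 * (1 + (n + card (arcs_final xs)) * n + empty_adds xs)"
    using t bfs_run.add_time[OF run n refl]
    by (simp add: update_time_def power2_eq_square algebra_simps)
  fix k assume k: "k < length xs"
  {
    fix S assume "xs ! k = TcCover S"
    note bounds = bfs_run.cover_bounds[OF run k this]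
    have *: "x \<le> 11 * y + 9 \<Longrightarrow> x \<le> 47 * (1 + y)" "x \<le> y \<Longrightarrow> x \<le> 47 * y" for x y :: nat
      by simp_all
    show "fst (h ! k) \<le> 47 * (1 + min ((card (set S))\<^sup>2) (card (arcs_before xs k)))"
      using bounds(1) by (rule *(1))
    show "card (set (cover_arcs (snd (h ! k)))) \<le>
        47 * min ((card (set S))\<^sup>2) (card (arcs_before xs k))"
      using bounds(2) by (rule *(2))
  }
  assume "xs ! k = TcWitList"
  note bounds = bfs_run.witlist_bounds[OF run k this]
  show "length (result_wl (snd (h ! k))) \<le> 47 * n\<^sup>2" using bounds(2) unfolding n by linarith
  show "fst (h ! k) \<le> 47 * (1 + n\<^sup>2)" using bounds(1) by simp
qed

end
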